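(* Let $R$ be a commutative ring with identity and let $M$ be a flat $R$-module. Then the following are equivalent: (1) the trivial extension $A=R\propto M$ is a CS ring; (2) $R$ and $M$ are weakly IN $R$-modules and $\mathrm{Ann}_R(M)$ is a direct summand of $R$; (3) $R$ and $M$ are strongly CS $R$-modules and $\mathrm{Ann}_R(M)$ is a direct summand of $R$.
   Context: All rings are commutative with identity and all modules are unital. For an $R$-module $N$, $\mathrm{Ann}_R(N)=\{r\in R\mid rN=0\}$. The trivial extension $R\propto M$ is the abelian group $R\oplus M$ with multiplication $(a,x)(b,y)=(ab,ay+bx)$. A module is CS if every submodule is an essential submodule of a direct summand; a ring is a CS ring if it is CS as a module over itself. An $R$-module $M$ is weakly IN if $\mathrm{Ann}_R(N)+\mathrm{Ann}_R(L)=R$ for all submodules $N,L$ of $M$ with $N\cap L=0$. $M$ is strongly CS if for every submodule $N$ of $M$ there exists an idempotent $e=e^2\in R$ such that $N$ is an essential submodule of $eM$. *)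

theory Defs
  imports "HOL-Algebra.Module" "HOL-Algebra.AbelCoset" "HOL-Algebra.Free_Abelian_Groups"
begin

section \<open>Modules and trivial extensions\<close>

text \<open>The junk fields \<open>mult\<close> and \<open>one\<close>, which every \<open>module\<close> record has, are taken from \<open>R\<close>.\<close>

definition regular_module :: "('a, 'r) ring_scheme \<Rightarrow> ('a, 'a) module"
  where "regular_module R =
    \<lparr>carrier = carrier R, monoid.mult = monoid.mult R, one = one R,
     ring.zero = ring.zero R, ring.add = ring.add R, smult = monoid.mult R\<rparr>"

definition trivial_extension ::
  "('a, 'r) ring_scheme \<Rightarrow> ('a, 'b, 'm) module_scheme \<Rightarrow> ('a \<times> 'b) ring"
  where "trivial_extension R M =
    \<lparr>carrier = carrier R \<times> carrier M,
     monoid.mult = (\<lambda>(a, x) (b, y). (a \<otimes>\<^bsub>R\<^esub> b, a \<odot>\<^bsub>M\<^esub> y \<oplus>\<^bsub>M\<^esub> b \<odot>\<^bsub>M\<^esub> x)),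
     one = (\<one>\<^bsub>R\<^esub>, \<zero>\<^bsub>M\<^esub>),
     ring.zero = (\<zero>\<^bsub>R\<^esub>, \<zero>\<^bsub>M\<^esub>),
     ring.add = (\<lambda>(a, x) (b, y). (a \<oplus>\<^bsub>R\<^esub> b, x \<oplus>\<^bsub>M\<^esub> y))\<rparr>"

definition annihilator ::
  "('a, 'r) ring_scheme \<Rightarrow> ('a, 'b, 'm) module_scheme \<Rightarrow> 'b set \<Rightarrow> 'a set"
  where "annihilator R M N = {r \<in> carrier R. \<forall>x\<in>N. r \<odot>\<^bsub>M\<^esub> x = \<zero>\<^bsub>M\<^esub>}"


section \<open>CS, strongly CS and weakly IN modules\<close>

definition direct_summand ::
  "('a, 'r) ring_scheme \<Rightarrow> ('a, 'b, 'm) module_scheme \<Rightarrow> 'b set \<Rightarrow> bool"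
  where "direct_summand R M K \<longleftrightarrow> submodule K R M \<and>
    (\<exists>L. submodule L R M \<and> K \<inter> L = {\<zero>\<^bsub>M\<^esub>} \<and> K <+>\<^bsub>M\<^esub> L = carrier M)"

text \<open>\<open>essential_in R M N K\<close>: \<open>N\<close> is an essential submodule of the submodule \<open>K\<close> of \<open>M\<close>.\<close>

definition essential_in ::
  "('a, 'r) ring_scheme \<Rightarrow> ('a, 'b, 'm) module_scheme \<Rightarrow> 'b set \<Rightarrow> 'b set \<Rightarrow> bool"
  where "essential_in R M N K \<longleftrightarrow>
    submodule N R M \<and> submodule K R M \<and> N \<subseteq> K \<and>
    (\<forall>L. submodule L R M \<and> L \<subseteq> K \<and> N \<inter> L = {\<zero>\<^bsub>M\<^esub>} \<longrightarrow> L = {\<zero>\<^bsub>M\<^esub>})"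

definition CS_module :: "('a, 'r) ring_scheme \<Rightarrow> ('a, 'b, 'm) module_scheme \<Rightarrow> bool"
  where "CS_module R M \<longleftrightarrow>
    (\<forall>N. submodule N R M \<longrightarrow> (\<exists>K. direct_summand R M K \<and> essential_in R M N K))"

definition CS_ring :: "('a, 'r) ring_scheme \<Rightarrow> bool"
  where "CS_ring R \<longleftrightarrow> CS_module R (regular_module R)"

definition weakly_IN :: "('a, 'r) ring_scheme \<Rightarrow> ('a, 'b, 'm) module_scheme \<Rightarrow> bool"
  where "weakly_IN R M \<longleftrightarrow>
    (\<forall>N L. submodule N R M \<and> submodule L R M \<and> N \<inter> L = {\<zero>\<^bsub>M\<^esub>} \<longrightarrow>
      annihilator R M N <+>\<^bsub>R\<^esub> annihilator R M L = carrier R)"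

definition strongly_CS :: "('a, 'r) ring_scheme \<Rightarrow> ('a, 'b, 'm) module_scheme \<Rightarrow> bool"
  where "strongly_CS R M \<longleftrightarrow>
    (\<forall>N. submodule N R M \<longrightarrow>
      (\<exists>e\<in>carrier R. e \<otimes>\<^bsub>R\<^esub> e = e \<and> essential_in R M N ((\<lambda>x. e \<odot>\<^bsub>M\<^esub> x) ` carrier M)))"


section \<open>Tensor products and flatness\<close>

text \<open>\<open>N \<otimes>\<^sub>R M\<close> is the free abelian group on \<open>N \<times> M\<close> modulo the biadditivity and balancing
  relations. Only its group structure is needed to speak about injectivity of \<open>f \<otimes> id\<close>.\<close>

definition tensor_rels ::
  "('a, 'r) ring_scheme \<Rightarrow> ('a, 'c, 'n) module_scheme \<Rightarrow> ('a, 'b, 'm) module_scheme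
    \<Rightarrow> ('c \<times> 'b \<Rightarrow>\<^sub>0 int) set"
  where "tensor_rels R N M = generate (free_Abelian_group (carrier N \<times> carrier M))
    ({frag_of (n \<oplus>\<^bsub>N\<^esub> n', x) - frag_of (n, x) - frag_of (n', x) | n n' x.
        n \<in> carrier N \<and> n' \<in> carrier N \<and> x \<in> carrier M} \<union>
     {frag_of (n, x \<oplus>\<^bsub>M\<^esub> x') - frag_of (n, x) - frag_of (n, x') | n x x'.
        n \<in> carrier N \<and> x \<in> carrier M \<and> x' \<in> carrier M} \<union>
     {frag_of (r \<odot>\<^bsub>N\<^esub> n, x) - frag_of (n, r \<odot>\<^bsub>M\<^esub> x) | r n x.
        r \<in> carrier R \<and> n \<in> carrier N \<and> x \<in> carrier M})"

definition tensor ::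
  "('a, 'r) ring_scheme \<Rightarrow> ('a, 'c, 'n) module_scheme \<Rightarrow> ('a, 'b, 'm) module_scheme
    \<Rightarrow> ('c \<times> 'b \<Rightarrow>\<^sub>0 int) set monoid"
  where "tensor R N M = free_Abelian_group (carrier N \<times> carrier M) Mod tensor_rels R N M"

definition module_hom ::
  "('a, 'r) ring_scheme \<Rightarrow> ('a, 'c, 'n) module_scheme \<Rightarrow> ('a, 'd, 'p) module_scheme
    \<Rightarrow> ('c \<Rightarrow> 'd) set"
  where "module_hom R N P = {f \<in> hom (add_monoid N) (add_monoid P).
    \<forall>r\<in>carrier R. \<forall>x\<in>carrier N. f (r \<odot>\<^bsub>N\<^esub> x) = r \<odot>\<^bsub>P\<^esub> f x}"

definition tensor_free_map :: "('c \<Rightarrow> 'd) \<Rightarrow> ('c \<times> 'b \<Rightarrow>\<^sub>0 int) \<Rightarrow> ('d \<times> 'b \<Rightarrow>\<^sub>0 int)"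
  where "tensor_free_map f = frag_extend (\<lambda>(n, x). frag_of (f n, x))"

text \<open>The homomorphism \<open>f \<otimes> id : N \<otimes> M \<rightarrow> P \<otimes> M\<close>, which sends the coset of \<open>z\<close> to the coset of
  \<open>tensor_free_map f z\<close>; see the lemma \<open>tensor_map_coset\<close>. The source \<open>N\<close> is not an argument.\<close>

definition tensor_map ::
  "('a, 'r) ring_scheme \<Rightarrow> ('a, 'd, 'p) module_scheme \<Rightarrow> ('a, 'b, 'm) module_scheme
    \<Rightarrow> ('c \<Rightarrow> 'd) \<Rightarrow> ('c \<times> 'b \<Rightarrow>\<^sub>0 int) set \<Rightarrow> ('d \<times> 'b \<Rightarrow>\<^sub>0 int) set"
  where "tensor_map R P M f X = the_elem
    ((\<lambda>z. r_coset (free_Abelian_group (carrier P \<times> carrier M)) (tensor_rels R P M)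
       (tensor_free_map f z)) ` X)"

text \<open>\<open>M\<close> is flat if tensoring with \<open>M\<close> preserves injectivity of homomorphisms \<open>f : N \<rightarrow> P\<close>.
  A HOL formula cannot quantify over all types, so \<open>N\<close> and \<open>P\<close> have carriers in the
  fixed type \<open>'a list set\<close>. Up to isomorphism this type carries every ideal of \<open>R\<close>
  (through \<open>a \<mapsto> {[a]}\<close>) and every finitely generated \<open>R\<close>-module with all its submodules (elements
  of a quotient of \<open>R\<^sup>n\<close> are cosets, i.e. sets of lists), so by the ideal criterion the condition
  is equivalent to the one over all modules.\<close>

definition flat_module :: "('a, 'r) ring_scheme \<Rightarrow> ('a, 'b, 'm) module_scheme \<Rightarrow> bool"
  where "flat_module R M \<longleftrightarrow> module R M \<and>
    (\<forall>(N :: ('a, 'a list set) module) (P :: ('a, 'a list set) module) f.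
      module R N \<and> module R P \<and> f \<in> module_hom R N P \<and> inj_on f (carrier N) \<longrightarrow>
      inj_on (tensor_map R P M f) (carrier (tensor R N M)))"


section \<open>Well-definedness\<close>

lemma regular_module_is_module:
  assumes "cring R" shows "module R (regular_module R)"
proof -
  interpret cring R by fact
  have "abelian_group (regular_module R)"
    using l_neg by (intro abelian_groupI) (auto simp: regular_module_def a_ac)
  then show ?thesis
    by (intro moduleI assms) (simp_all add: regular_module_def l_distr r_distr m_assoc)
qed

lemma trivial_extension_is_cring:
  assumes "module R M" shows "cring (trivial_extension R M)"
proof -
  interpret module R M by fact
  show ?thesis
  proof (rule cringI)
    show "abelian_group (trivial_extension R M)"
    proof (rule abelian_groupI)
      fix p assume "p \<in> carrier (trivial_extension R M)"
      then show "\<exists>q\<in>carrier (trivial_extension R M).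
          q \<oplus>\<^bsub>trivial_extension R M\<^esub> p = \<zero>\<^bsub>trivial_extension R M\<^esub>"
        by (intro bexI[of _ "(\<ominus>\<^bsub>R\<^esub> fst p, \<ominus>\<^bsub>M\<^esub> snd p)"])
           (auto simp: trivial_extension_def R.l_neg M.l_neg)
    qed (auto simp: trivial_extension_def R.a_ac M.a_ac)
    show "comm_monoid (trivial_extension R M)"
    proof (rule comm_monoidI)
      fix p q r assume "p \<in> carrier (trivial_extension R M)"
        "q \<in> carrier (trivial_extension R M)" "r \<in> carrier (trivial_extension R M)"
      then show "p \<otimes>\<^bsub>trivial_extension R M\<^esub> q \<otimes>\<^bsub>trivial_extension R M\<^esub> r =
          p \<otimes>\<^bsub>trivial_extension R M\<^esub> (q \<otimes>\<^bsub>trivial_extension R M\<^esub> r)"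
        by (auto simp: trivial_extension_def smult_r_distr smult_assoc1[symmetric]
              R.m_ac M.a_assoc)
    qed (auto simp: trivial_extension_def R.m_comm M.a_comm)
  qed (auto simp: trivial_extension_def R.l_distr smult_l_distr smult_r_distr M.a_ac)
qed

lemma subgroup_tensor_rels:
  assumes "module R N" "module R M"
  shows "subgroup (tensor_rels R N M) (free_Abelian_group (carrier N \<times> carrier M))"
proof -
  interpret N: module R N by fact
  interpret M: module R M by fact
  have "frag_of z \<in> carrier (free_Abelian_group (carrier N \<times> carrier M))"
    if "z \<in> carrier N \<times> carrier M" for z
    using that by (simp add: carrier_free_Abelian_group_iff)
  moreover have "a - b \<in> carrier (free_Abelian_group (carrier N \<times> carrier M))"
    if "a \<in> carrier (free_Abelian_group (carrier N \<times> carrier M))"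
       "b \<in> carrier (free_Abelian_group (carrier N \<times> carrier M))" for a b
    using that keys_diff[of a b] by (auto simp: carrier_free_Abelian_group_iff)
  ultimately show ?thesis
    unfolding tensor_rels_def
    by (intro group.generate_is_subgroup group_free_Abelian_group) auto
qed

lemma tensor_free_map_closed:
  assumes "f \<in> module_hom R N P" "z \<in> carrier (free_Abelian_group (carrier N \<times> carrier M))"
  shows "tensor_free_map f z \<in> carrier (free_Abelian_group (carrier P \<times> carrier M))"
proof -
  have "Poly_Mapping.keys (tensor_free_map f z) \<subseteq>
      (\<Union>i\<in>Poly_Mapping.keys z. Poly_Mapping.keys (case i of (n, x) \<Rightarrow> frag_of (f n, x)))"
    unfolding tensor_free_map_def by (rule keys_frag_extend)
  also have "\<dots> \<subseteq> carrier P \<times> carrier M"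
    using assms by (force simp: carrier_free_Abelian_group_iff module_hom_def hom_def)
  finally show ?thesis
    by (simp add: carrier_free_Abelian_group_iff)
qed

lemma tensor_free_map_rels:
  assumes "module R N" "module R P" "module R M" "f \<in> module_hom R N P"
    and "z \<in> tensor_rels R N M"
  shows "tensor_free_map f z \<in> tensor_rels R P M"
proof -
  interpret N: module R N by fact
  interpret P: module R P by fact
  interpret M: module R M by fact
  note sg = subgroup_tensor_rels[OF assms(2,3)] and sgN = subgroup_tensor_rels[OF assms(1,3)]
  have f: "n \<in> carrier N \<Longrightarrow> f n \<in> carrier P"
    "\<lbrakk>n \<in> carrier N; n' \<in> carrier N\<rbrakk> \<Longrightarrow> f (n \<oplus>\<^bsub>N\<^esub> n') = f n \<oplus>\<^bsub>P\<^esub> f n'"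
    "\<lbrakk>r \<in> carrier R; n \<in> carrier N\<rbrakk> \<Longrightarrow> f (r \<odot>\<^bsub>N\<^esub> n) = r \<odot>\<^bsub>P\<^esub> f n" for n n' r
    using assms(4) by (auto simp: module_hom_def hom_def)
  define gens where "gens =
     {frag_of (n \<oplus>\<^bsub>N\<^esub> n', x) - frag_of (n, x) - frag_of (n', x) | n n' x.
        n \<in> carrier N \<and> n' \<in> carrier N \<and> x \<in> carrier M} \<union>
     {frag_of (n, x \<oplus>\<^bsub>M\<^esub> x') - frag_of (n, x) - frag_of (n, x') | n x x'.
        n \<in> carrier N \<and> x \<in> carrier M \<and> x' \<in> carrier M} \<union>
     {frag_of (r \<odot>\<^bsub>N\<^esub> n, x) - frag_of (n, r \<odot>\<^bsub>M\<^esub> x) | r n x.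
        r \<in> carrier R \<and> n \<in> carrier N \<and> x \<in> carrier M}"
  have rels: "tensor_rels R N M = generate (free_Abelian_group (carrier N \<times> carrier M)) gens"
    unfolding tensor_rels_def gens_def ..
  have gen: "tensor_free_map f h \<in> tensor_rels R P M" if "h \<in> gens" for h
    using that unfolding gens_def
  proof (elim UnE CollectE exE conjE)
    fix n n' x assume "h = frag_of (n \<oplus>\<^bsub>N\<^esub> n', x) - frag_of (n, x) - frag_of (n', x)"
      "n \<in> carrier N" "n' \<in> carrier N" "x \<in> carrier M"
    then show ?thesis
      using f unfolding tensor_rels_def
      by (intro generate.incl UnI1 CollectI exI[of _ "f n"] exI[of _ "f n'"] exI[of _ x])
         (simp add: tensor_free_map_def frag_extend_diff)
  next
    fix n x x' assume "h = frag_of (n, x \<oplus>\<^bsub>M\<^esub> x') - frag_of (n, x) - frag_of (n, x')"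
      "n \<in> carrier N" "x \<in> carrier M" "x' \<in> carrier M"
    then show ?thesis
      using f unfolding tensor_rels_def
      by (intro generate.incl UnI1[OF UnI2] CollectI exI[of _ "f n"] exI[of _ x] exI[of _ x'])
         (simp add: tensor_free_map_def frag_extend_diff)
  next
    fix r n x assume "h = frag_of (r \<odot>\<^bsub>N\<^esub> n, x) - frag_of (n, r \<odot>\<^bsub>M\<^esub> x)"
      "r \<in> carrier R" "n \<in> carrier N" "x \<in> carrier M"
    then show ?thesis
      using f unfolding tensor_rels_def
      by (intro generate.incl UnI2 CollectI exI[of _ r] exI[of _ "f n"] exI[of _ x])
         (simp add: tensor_free_map_def frag_extend_diff)
  qed
  show ?thesis
    using assms(5) unfolding rels
  proof (induction rule: generate.induct)
    case one
    then show ?case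
      using subgroup.one_closed[OF sg] by (simp add: tensor_free_map_def)
  next
    case (incl h)
    then show ?case by (rule gen)
  next
    case (inv h)
    have "h \<in> carrier (free_Abelian_group (carrier N \<times> carrier M))"
      using generate.incl[OF inv] by (intro subgroup.mem_carrier[OF sgN]) (simp only: rels)
    moreover have "tensor_free_map f h \<in> carrier (free_Abelian_group (carrier P \<times> carrier M))"
      using gen[OF inv] by (rule subgroup.mem_carrier[OF sg])
    ultimately show ?case
      using subgroup.m_inv_closed[OF sg gen[OF inv]]
      by (simp add: tensor_free_map_def frag_extend_minus)
  next
    case (eng h1 h2)
    then show ?case
      using subgroup.m_closed[OF sg eng(3,4)] by (simp add: tensor_free_map_def frag_extend_add)
  qed
qed

lemma tensor_map_coset:
  assumes "module R N" "module R P" "module R M" "f \<in> module_hom R N P"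
    and z: "z \<in> carrier (free_Abelian_group (carrier N \<times> carrier M))"
  shows "tensor_map R P M f
      (r_coset (free_Abelian_group (carrier N \<times> carrier M)) (tensor_rels R N M) z)
    = r_coset (free_Abelian_group (carrier P \<times> carrier M)) (tensor_rels R P M) (tensor_free_map f z)"
proof -
  let ?N = "free_Abelian_group (carrier N \<times> carrier M)"
  let ?P = "free_Abelian_group (carrier P \<times> carrier M)"
  interpret P: group ?P by (rule group_free_Abelian_group)
  note sgN = subgroup_tensor_rels[OF assms(1,3)] and sgP = subgroup_tensor_rels[OF assms(2,3)]
  have *: "r_coset ?P (tensor_rels R P M) (tensor_free_map f (h + z))
      = r_coset ?P (tensor_rels R P M) (tensor_free_map f z)"
    if "h \<in> tensor_rels R N M" for h
  proof -
    have h: "tensor_free_map f h \<in> tensor_rels R P M"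
      by (rule tensor_free_map_rels[OF assms(1-4) that])
    have "tensor_free_map f (h + z) = tensor_free_map f h \<otimes>\<^bsub>?P\<^esub> tensor_free_map f z"
      by (simp add: tensor_free_map_def frag_extend_add)
    then show ?thesis
      using P.coset_join2[OF subgroup.mem_carrier[OF sgP h] sgP h]
        P.coset_mult_assoc[OF subgroup.subset[OF sgP] subgroup.mem_carrier[OF sgP h]
          tensor_free_map_closed[OF assms(4) z]]
      by simp
  qed
  have "(\<lambda>z. r_coset ?P (tensor_rels R P M) (tensor_free_map f z)) ` (r_coset ?N (tensor_rels R N M) z)
      = {r_coset ?P (tensor_rels R P M) (tensor_free_map f z)}"
    using * subgroup.one_closed[OF sgN] by (auto simp: r_coset_def image_iff intro!: bexI)
  then show ?thesis
    by (simp add: tensor_map_def)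
qed

end

theory Submission
  imports Defs
begin

text \<open>Write \<open>A\<close> for the trivial extension. Direct summands of a commutative ring are generated by
  idempotents, so \<open>A\<close> is a CS ring exactly if it is strongly CS over itself
  (\<open>CS_ring_iff_strongly_CS\<close>). Moreover, every idempotent of \<open>A\<close> has the form \<open>(e, 0)\<close> with \<open>e\<close> an
  idempotent of \<open>R\<close> (\<open>trivial_extension_idempotent\<close>), so the CS property of \<open>A\<close> is about essential
  extensions inside the ideals \<open>eR \<times> eM\<close>.

  Going down from \<open>A\<close>, the ideals \<open>0 \<times> N\<close> show that \<open>M\<close> is strongly CS, and \<open>0 \<times> M\<close> shows that
  \<open>Ann M\<close> is a direct summand. For an ideal \<open>J\<close> of \<open>R\<close> the suitable ideal of \<open>A\<close> is \<open>J \<times> JM\<close>.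
  This is where flatness enters: \<open>xR \<inter> J = 0\<close> implies \<open>xM \<inter> JM = 0\<close> (\<open>flat_smult_eq_zero\<close>).

  Going up to \<open>A\<close> (\<open>trivial_extension_strongly_CS\<close>), the summand \<open>Ann M\<close> splits off as a ring factor
  of \<open>A\<close>, in which only \<open>R\<close> matters. In the other factor \<open>M\<close> is faithful, and an ideal of \<open>A\<close> is
  controlled by its intersection with \<open>0 \<times> M\<close>.

  Finally, strongly CS modules are weakly IN because an idempotent that fixes \<open>N\<close> elementwise and
  has \<open>N\<close> essential in its image annihilates every \<open>L\<close> with \<open>N \<inter> L = 0\<close>. Conversely, the weakly IN
  property applied to two submodules that are maximal with respect to having zero intersection
  yields a ring element that acts as a projection (\<open>weakly_IN_imp_projection\<close>), and it can be made
  idempotent in \<open>R\<close> when \<open>Ann M\<close> is a direct summand (\<open>weakly_IN_imp_strongly_CS\<close>).\<close>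

section \<open>Submodules and essential extensions\<close>

context module
begin

lemma submodule_zero: "submodule N R M \<Longrightarrow> \<zero>\<^bsub>M\<^esub> \<in> N"
  using submoduleE(1,2,4)[of N] by (metis R.zero_closed equals0I smult_l_null subsetD)

lemma submodule_add_cancel:
  assumes "submodule N R M" "x \<in> N" "y \<in> carrier M" "x \<oplus>\<^bsub>M\<^esub> y \<in> N"
  shows "y \<in> N"
proof -
  have "x \<in> carrier M"
    using assms submoduleE(1) by blast
  then have "y = \<ominus>\<^bsub>M\<^esub> x \<oplus>\<^bsub>M\<^esub> (x \<oplus>\<^bsub>M\<^esub> y)"
    using assms(3) by (simp add: M.r_neg1)
  then show ?thesis
    using submoduleE(3,5)[OF assms(1)] assms(2,4) by metis
qed

lemma submodule_if_add_smult_closed: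
  assumes "N \<subseteq> carrier M" "\<zero>\<^bsub>M\<^esub> \<in> N"
    and "\<And>x y. x \<in> N \<Longrightarrow> y \<in> N \<Longrightarrow> x \<oplus>\<^bsub>M\<^esub> y \<in> N"
    and smult: "\<And>r x. r \<in> carrier R \<Longrightarrow> x \<in> N \<Longrightarrow> r \<odot>\<^bsub>M\<^esub> x \<in> N"
  shows "submodule N R M"
proof (rule submoduleI)
  fix x assume "x \<in> N"
  then show "\<ominus>\<^bsub>M\<^esub> x \<in> N"
    using smult[of "\<ominus> \<one>" x] assms(1) by (simp add: smult_l_minus subset_iff)
qed (use assms in auto)

lemma submodule_zero_set: "submodule {\<zero>\<^bsub>M\<^esub>} R M"
  by (rule submoduleI) auto

lemma submodule_cyclic:
  assumes "x \<in> carrier M"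
  shows "submodule ((\<lambda>r. r \<odot>\<^bsub>M\<^esub> x) ` carrier R) R M"
proof (rule submodule_if_add_smult_closed)
  show "\<zero>\<^bsub>M\<^esub> \<in> (\<lambda>r. r \<odot>\<^bsub>M\<^esub> x) ` carrier R"
    using assms by (intro image_eqI[of _ _ \<zero>]) auto
next
  fix a b assume "a \<in> (\<lambda>r. r \<odot>\<^bsub>M\<^esub> x) ` carrier R" "b \<in> (\<lambda>r. r \<odot>\<^bsub>M\<^esub> x) ` carrier R"
  then show "a \<oplus>\<^bsub>M\<^esub> b \<in> (\<lambda>r. r \<odot>\<^bsub>M\<^esub> x) ` carrier R"
    using assms by (auto simp: smult_l_distr[symmetric])
next
  fix s a assume "s \<in> carrier R" "a \<in> (\<lambda>r. r \<odot>\<^bsub>M\<^esub> x) ` carrier R"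
  then show "s \<odot>\<^bsub>M\<^esub> a \<in> (\<lambda>r. r \<odot>\<^bsub>M\<^esub> x) ` carrier R"
    using assms by (auto simp: smult_assoc1[symmetric])
qed (use assms in auto)

lemma submodule_smult_image:
  assumes "e \<in> carrier R"
  shows "submodule ((\<lambda>x. e \<odot>\<^bsub>M\<^esub> x) ` carrier M) R M"
proof (rule submodule_if_add_smult_closed)
  show "\<zero>\<^bsub>M\<^esub> \<in> (\<lambda>x. e \<odot>\<^bsub>M\<^esub> x) ` carrier M"
    using assms by (intro image_eqI[of _ _ "\<zero>\<^bsub>M\<^esub>"]) auto
next
  fix a b assume "a \<in> (\<lambda>x. e \<odot>\<^bsub>M\<^esub> x) ` carrier M" "b \<in> (\<lambda>x. e \<odot>\<^bsub>M\<^esub> x) ` carrier M"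
  then show "a \<oplus>\<^bsub>M\<^esub> b \<in> (\<lambda>x. e \<odot>\<^bsub>M\<^esub> x) ` carrier M"
    using assms by (auto simp: smult_r_distr[symmetric])
next
  fix s a assume s: "s \<in> carrier R" and "a \<in> (\<lambda>x. e \<odot>\<^bsub>M\<^esub> x) ` carrier M"
  then obtain x where "x \<in> carrier M" "a = e \<odot>\<^bsub>M\<^esub> x"
    by auto
  then have "s \<odot>\<^bsub>M\<^esub> a = e \<odot>\<^bsub>M\<^esub> (s \<odot>\<^bsub>M\<^esub> x)"
    using assms s by (metis R.m_comm smult_assoc1)
  then show "s \<odot>\<^bsub>M\<^esub> a \<in> (\<lambda>x. e \<odot>\<^bsub>M\<^esub> x) ` carrier M"
    using s \<open>x \<in> carrier M\<close> by auto
qed (use assms in auto)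

lemma smult_idempotent:
  assumes "e \<in> carrier R" "e \<otimes> e = e" "x \<in> (\<lambda>x. e \<odot>\<^bsub>M\<^esub> x) ` carrier M"
  shows "e \<odot>\<^bsub>M\<^esub> x = x"
  using assms by (auto simp: smult_assoc1[symmetric])

lemma mem_set_add_iff:
  "z \<in> N <+>\<^bsub>M\<^esub> L \<longleftrightarrow> (\<exists>x\<in>N. \<exists>y\<in>L. z = x \<oplus>\<^bsub>M\<^esub> y)"
  by (auto simp: set_add_def')

lemma submodule_set_add:
  assumes N: "submodule N R M" and L: "submodule L R M"
  shows "submodule (N <+>\<^bsub>M\<^esub> L) R M" "N \<subseteq> N <+>\<^bsub>M\<^esub> L" "L \<subseteq> N <+>\<^bsub>M\<^esub> L"
proof -
  note c = subsetD[OF submoduleE(1)[OF N]] subsetD[OF submoduleE(1)[OF L]]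
  show "N \<subseteq> N <+>\<^bsub>M\<^esub> L" "L \<subseteq> N <+>\<^bsub>M\<^esub> L"
    using submodule_zero[OF N] submodule_zero[OF L] c
    by (auto simp: mem_set_add_iff) (metis M.r_zero, metis M.l_zero)
  show "submodule (N <+>\<^bsub>M\<^esub> L) R M"
  proof (rule submodule_if_add_smult_closed)
    show "\<zero>\<^bsub>M\<^esub> \<in> N <+>\<^bsub>M\<^esub> L"
      using \<open>N \<subseteq> N <+>\<^bsub>M\<^esub> L\<close> submodule_zero[OF N] by auto
  next
    fix a b assume "a \<in> N <+>\<^bsub>M\<^esub> L" "b \<in> N <+>\<^bsub>M\<^esub> L"
    then obtain x y x' y' where xy: "x \<in> N" "y \<in> L" "x' \<in> N" "y' \<in> L"
      "a = x \<oplus>\<^bsub>M\<^esub> y" "b = x' \<oplus>\<^bsub>M\<^esub> y'"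
      by (auto simp: mem_set_add_iff)
    then have "a \<oplus>\<^bsub>M\<^esub> b = (x \<oplus>\<^bsub>M\<^esub> x') \<oplus>\<^bsub>M\<^esub> (y \<oplus>\<^bsub>M\<^esub> y')"
      using c by (simp add: M.a_ac)
    then show "a \<oplus>\<^bsub>M\<^esub> b \<in> N <+>\<^bsub>M\<^esub> L"
      using xy submoduleE(5)[OF N] submoduleE(5)[OF L] unfolding mem_set_add_iff by blast
  next
    fix s a assume "s \<in> carrier R" "a \<in> N <+>\<^bsub>M\<^esub> L"
    then show "s \<odot>\<^bsub>M\<^esub> a \<in> N <+>\<^bsub>M\<^esub> L"
      using c submoduleE(4)[OF N] submoduleE(4)[OF L] smult_r_distr
      unfolding mem_set_add_iff by metis
  qed (use c in \<open>auto simp: mem_set_add_iff\<close>)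
qed

text \<open>It suffices to test essentiality on cyclic submodules, which turns it into a statement
  about elements: every nonzero element of the larger module has a nonzero multiple in the
  smaller one.\<close>

lemma essential_in_iff:
  "essential_in R M N K \<longleftrightarrow>
    submodule N R M \<and> submodule K R M \<and> N \<subseteq> K \<and>
    (\<forall>x\<in>K. x \<noteq> \<zero>\<^bsub>M\<^esub> \<longrightarrow> (\<exists>r\<in>carrier R. r \<odot>\<^bsub>M\<^esub> x \<in> N \<and> r \<odot>\<^bsub>M\<^esub> x \<noteq> \<zero>\<^bsub>M\<^esub>))"
proof (intro iffI conjI ballI impI)
  fix x assume ess: "essential_in R M N K" and x: "x \<in> K" "x \<noteq> \<zero>\<^bsub>M\<^esub>"
  let ?L = "(\<lambda>r. r \<odot>\<^bsub>M\<^esub> x) ` carrier R"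
  have N: "submodule N R M" and K: "submodule K R M"
    using ess by (auto simp: essential_in_def)
  then have xM: "x \<in> carrier M"
    using x submoduleE(1) by blast
  then have L: "submodule ?L R M"
    by (rule submodule_cyclic)
  have "?L \<subseteq> K"
    using submoduleE(4)[OF K] x by auto
  moreover have "x \<in> ?L"
    using xM by (intro image_eqI[of _ _ \<one>]) auto
  ultimately have "N \<inter> ?L \<noteq> {\<zero>\<^bsub>M\<^esub>}"
    using ess L x unfolding essential_in_def by blast
  then show "\<exists>r\<in>carrier R. r \<odot>\<^bsub>M\<^esub> x \<in> N \<and> r \<odot>\<^bsub>M\<^esub> x \<noteq> \<zero>\<^bsub>M\<^esub>"
    using submodule_zero[OF N] submodule_zero[OF L] by blast
next
  assume *: "submodule N R M \<and> submodule K R M \<and> N \<subseteq> K \<and>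
    (\<forall>x\<in>K. x \<noteq> \<zero>\<^bsub>M\<^esub> \<longrightarrow> (\<exists>r\<in>carrier R. r \<odot>\<^bsub>M\<^esub> x \<in> N \<and> r \<odot>\<^bsub>M\<^esub> x \<noteq> \<zero>\<^bsub>M\<^esub>))"
  have "x = \<zero>\<^bsub>M\<^esub>" if "submodule L R M" "L \<subseteq> K" "N \<inter> L = {\<zero>\<^bsub>M\<^esub>}" "x \<in> L" for L x
  proof (rule ccontr)
    assume "x \<noteq> \<zero>\<^bsub>M\<^esub>"
    moreover have "x \<in> K"
      using that by blast
    ultimately obtain r where "r \<in> carrier R" "r \<odot>\<^bsub>M\<^esub> x \<in> N" "r \<odot>\<^bsub>M\<^esub> x \<noteq> \<zero>\<^bsub>M\<^esub>"
      using * by blast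
    moreover have "r \<odot>\<^bsub>M\<^esub> x \<in> L"
      using submoduleE(4)[OF that(1)] that(4) calculation(1) by blast
    ultimately show False
      using that(3) by blast
  qed
  then have "L = {\<zero>\<^bsub>M\<^esub>}" if "submodule L R M" "L \<subseteq> K" "N \<inter> L = {\<zero>\<^bsub>M\<^esub>}" for L
    using that(1)[THEN submodule_zero] that by (intro equalityI subsetI) auto
  then show "essential_in R M N K"
    using * by (simp add: essential_in_def)
qed (auto simp: essential_in_def)

lemma essential_inE:
  assumes "essential_in R M N K" "x \<in> K" "x \<noteq> \<zero>\<^bsub>M\<^esub>"
  obtains r where "r \<in> carrier R" "r \<odot>\<^bsub>M\<^esub> x \<in> N" "r \<odot>\<^bsub>M\<^esub> x \<noteq> \<zero>\<^bsub>M\<^esub>"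
  using assms unfolding essential_in_iff by auto

lemma exists_maximal_disjoint_submodule:
  assumes N: "submodule N R M" and NL: "N \<inter> L = {\<zero>\<^bsub>M\<^esub>}"
  obtains K where "submodule K R M" "N \<subseteq> K" "K \<inter> L = {\<zero>\<^bsub>M\<^esub>}"
    "\<And>X. submodule X R M \<Longrightarrow> K \<subseteq> X \<Longrightarrow> X \<inter> L = {\<zero>\<^bsub>M\<^esub>} \<Longrightarrow> X = K"
proof -
  let ?A = "{K. submodule K R M \<and> N \<subseteq> K \<and> K \<inter> L = {\<zero>\<^bsub>M\<^esub>}}"
  have "\<exists>K\<in>?A. \<forall>X\<in>?A. K \<subseteq> X \<longrightarrow> X = K"
  proof (rule subset_Zorn_nonempty)
    show "?A \<noteq> {}"
      using N NL by blast
  next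
    fix C assume C: "C \<noteq> {}" "subset.chain ?A C"
    then have sub: "\<And>K. K \<in> C \<Longrightarrow> submodule K R M \<and> N \<subseteq> K \<and> K \<inter> L = {\<zero>\<^bsub>M\<^esub>}"
      by (auto simp: subset_chain_def)
    obtain K0 where K0: "K0 \<in> C"
      using C by blast
    have "submodule (\<Union>C) R M"
    proof (rule submodule_if_add_smult_closed)
      fix a b assume "a \<in> \<Union>C" "b \<in> \<Union>C"
      then obtain K where "K \<in> C" "a \<in> K" "b \<in> K"
        using C(2) unfolding subset_chain_def by blast
      then show "a \<oplus>\<^bsub>M\<^esub> b \<in> \<Union>C"
        using sub submoduleE(5) by blast
    next
      show "\<Union>C \<subseteq> carrier M"
        using sub submoduleE(1) by blast
      show "\<zero>\<^bsub>M\<^esub> \<in> \<Union>C"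
        using sub K0 by blast
      show "\<And>a x. a \<in> carrier R \<Longrightarrow> x \<in> \<Union>C \<Longrightarrow> a \<odot>\<^bsub>M\<^esub> x \<in> \<Union>C"
        using sub submoduleE(4) by blast
    qed
    moreover have "N \<subseteq> \<Union>C" "\<Union>C \<inter> L = {\<zero>\<^bsub>M\<^esub>}"
      using sub K0 by blast+
    ultimately show "\<Union>C \<in> ?A"
      by blast
  qed
  then obtain K where K: "K \<in> ?A" "\<forall>X\<in>?A. K \<subseteq> X \<longrightarrow> X = K"
    by blast
  show thesis
  proof (rule that[of K])
    show "X = K" if "submodule X R M" "K \<subseteq> X" "X \<inter> L = {\<zero>\<^bsub>M\<^esub>}" for X
      using K that by blast
  qed (use K in auto)
qed


section \<open>Weakly IN and strongly CS modules\<close>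

text \<open>If \<open>N\<close> is essential in \<open>eM\<close> and \<open>N \<inter> L = 0\<close>, then \<open>eL \<subseteq> eM \<inter> L\<close> avoids \<open>N\<close> and is therefore
  zero. So \<open>e\<close> annihilates \<open>L\<close>, while \<open>1 - e\<close> annihilates \<open>N\<close>.\<close>

lemma strongly_CS_imp_weakly_IN:
  assumes "strongly_CS R M"
  shows "weakly_IN R M"
  unfolding weakly_IN_def
proof (intro allI impI, elim conjE)
  fix N L assume N: "submodule N R M" and L: "submodule L R M" and NL: "N \<inter> L = {\<zero>\<^bsub>M\<^esub>}"
  obtain e where e: "e \<in> carrier R" "e \<otimes> e = e"
    and ess: "essential_in R M N ((\<lambda>x. e \<odot>\<^bsub>M\<^esub> x) ` carrier M)"
    using assms N unfolding strongly_CS_def by blast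
  have c: "x \<in> carrier M" if "x \<in> N \<or> x \<in> L" for x
    using that submoduleE(1)[OF N] submoduleE(1)[OF L] by blast
  have "e \<odot>\<^bsub>M\<^esub> x = \<zero>\<^bsub>M\<^esub>" if "x \<in> L" for x
  proof (rule ccontr)
    assume "e \<odot>\<^bsub>M\<^esub> x \<noteq> \<zero>\<^bsub>M\<^esub>"
    moreover have "e \<odot>\<^bsub>M\<^esub> x \<in> (\<lambda>x. e \<odot>\<^bsub>M\<^esub> x) ` carrier M"
      using c that by blast
    ultimately obtain r where "r \<in> carrier R" "r \<odot>\<^bsub>M\<^esub> (e \<odot>\<^bsub>M\<^esub> x) \<in> N" "r \<odot>\<^bsub>M\<^esub> (e \<odot>\<^bsub>M\<^esub> x) \<noteq> \<zero>\<^bsub>M\<^esub>"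
      using essential_inE[OF ess] by blast
    moreover have "r \<odot>\<^bsub>M\<^esub> (e \<odot>\<^bsub>M\<^esub> x) \<in> L"
      using submoduleE(4)[OF L] e that calculation(1) by blast
    ultimately show False
      using NL by blast
  qed
  then have eL: "e \<in> annihilator R M L"
    using e by (auto simp: annihilator_def)
  have "(\<one> \<ominus> e) \<odot>\<^bsub>M\<^esub> x = \<zero>\<^bsub>M\<^esub>" if "x \<in> N" for x
  proof -
    have "e \<odot>\<^bsub>M\<^esub> x = x"
      using ess that smult_idempotent[OF e] unfolding essential_in_iff by blast
    then show ?thesis
      using e c that by (simp add: R.minus_eq smult_l_distr smult_l_minus M.r_neg)
  qed
  then have eN: "\<one> \<ominus> e \<in> annihilator R M N"
    using e by (auto simp: annihilator_def)
  have "r \<in> annihilator R M N <+>\<^bsub>R\<^esub> annihilator R M L" if r: "r \<in> carrier R" for r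
  proof -
    have "r = r \<otimes> (\<one> \<ominus> e) \<oplus> r \<otimes> e"
      using e r by (simp add: R.r_distr[symmetric] R.minus_eq R.a_assoc R.l_neg)
    moreover have "r \<otimes> (\<one> \<ominus> e) \<in> annihilator R M N" "r \<otimes> e \<in> annihilator R M L"
      using eN eL r c by (auto simp: annihilator_def smult_assoc1)
    ultimately show ?thesis
      by (auto simp: set_add_def')
  qed
  then show "annihilator R M N <+>\<^bsub>R\<^esub> annihilator R M L = carrier R"
    by (auto simp: set_add_def' annihilator_def)
qed

text \<open>Let \<open>L\<close> be maximal with \<open>N \<inter> L = 0\<close> and let \<open>K \<supseteq> N\<close> be maximal with \<open>K \<inter> L = 0\<close>; then \<open>N\<close> is
  essential in \<open>K\<close>. Being weakly IN provides a ring element \<open>b\<close> that acts as the identity on \<open>K\<close>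
  and as zero on \<open>L\<close>. By maximality of \<open>L\<close>, only elements of \<open>L\<close> can be sent into \<open>L\<close> by \<open>b\<close>, so
  \<open>bM\<close>, which contains \<open>K\<close>, still meets \<open>L\<close> trivially. Hence \<open>bM = K\<close>, and \<open>b\<close> acts as a projection
  onto \<open>K\<close>.\<close>

lemma weakly_IN_imp_projection:
  assumes IN: "weakly_IN R M" and N: "submodule N R M"
  obtains b where "b \<in> carrier R" "\<And>x. x \<in> carrier M \<Longrightarrow> b \<odot>\<^bsub>M\<^esub> (b \<odot>\<^bsub>M\<^esub> x) = b \<odot>\<^bsub>M\<^esub> x"
    "essential_in R M N ((\<lambda>x. b \<odot>\<^bsub>M\<^esub> x) ` carrier M)"
proof -
  have "{\<zero>\<^bsub>M\<^esub>} \<inter> N = {\<zero>\<^bsub>M\<^esub>}"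
    using submodule_zero[OF N] by auto
  then obtain L where L: "submodule L R M" and LN: "L \<inter> N = {\<zero>\<^bsub>M\<^esub>}"
    and Lmax: "\<And>X. submodule X R M \<Longrightarrow> L \<subseteq> X \<Longrightarrow> X \<inter> N = {\<zero>\<^bsub>M\<^esub>} \<Longrightarrow> X = L"
    by (metis exists_maximal_disjoint_submodule submodule_zero_set)
  have "N \<inter> L = {\<zero>\<^bsub>M\<^esub>}"
    using LN by auto
  then obtain K where K: "submodule K R M" "N \<subseteq> K" and KL: "K \<inter> L = {\<zero>\<^bsub>M\<^esub>}"
    and Kmax: "\<And>X. submodule X R M \<Longrightarrow> K \<subseteq> X \<Longrightarrow> X \<inter> L = {\<zero>\<^bsub>M\<^esub>} \<Longrightarrow> X = K"
    using exists_maximal_disjoint_submodule[OF N] by metis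
  have c: "x \<in> carrier M" if "x \<in> K \<or> x \<in> L \<or> x \<in> N" for x
    using that submoduleE(1)[OF K(1)] submoduleE(1)[OF L] submoduleE(1)[OF N] by blast
  have "\<one> \<in> annihilator R M K <+>\<^bsub>R\<^esub> annihilator R M L"
    using IN K(1) L KL unfolding weakly_IN_def by auto
  then obtain a b where ab: "a \<in> annihilator R M K" "b \<in> annihilator R M L" "\<one> = a \<oplus> b"
    by (auto simp: set_add_def')
  then have a: "a \<in> carrier R" and b: "b \<in> carrier R"
    and aK: "\<And>x. x \<in> K \<Longrightarrow> a \<odot>\<^bsub>M\<^esub> x = \<zero>\<^bsub>M\<^esub>"
    and bL: "\<And>x. x \<in> L \<Longrightarrow> b \<odot>\<^bsub>M\<^esub> x = \<zero>\<^bsub>M\<^esub>"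
    by (auto simp: annihilator_def)
  have bK: "b \<odot>\<^bsub>M\<^esub> x = x" if "x \<in> K" for x
  proof -
    have "x = (a \<oplus> b) \<odot>\<^bsub>M\<^esub> x"
      unfolding ab(3)[symmetric] using c that by simp
    also have "\<dots> = b \<odot>\<^bsub>M\<^esub> x"
      using a b c that by (simp add: smult_l_distr aK)
    finally show ?thesis ..
  qed
  let ?B = "(\<lambda>x. b \<odot>\<^bsub>M\<^esub> x) ` carrier M"
  have "K \<subseteq> ?B"
  proof
    fix x assume "x \<in> K"
    then show "x \<in> ?B"
      using bK c by (intro image_eqI[of _ _ x]) auto
  qed
  moreover have "?B \<inter> L = {\<zero>\<^bsub>M\<^esub>}"
  proof -
    have "b \<odot>\<^bsub>M\<^esub> m = \<zero>\<^bsub>M\<^esub>" if m: "m \<in> carrier M" "b \<odot>\<^bsub>M\<^esub> m \<in> L" for m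
    proof (rule bL)
      let ?C = "(\<lambda>r. r \<odot>\<^bsub>M\<^esub> m) ` carrier R"
      note C = submodule_cyclic[OF m(1)]
      note LC = submodule_set_add[OF L C]
      have "n = \<zero>\<^bsub>M\<^esub>" if n: "n \<in> L <+>\<^bsub>M\<^esub> ?C" "n \<in> N" for n
      proof -
        obtain l r where lr: "l \<in> L" "r \<in> carrier R" "n = l \<oplus>\<^bsub>M\<^esub> r \<odot>\<^bsub>M\<^esub> m"
          using n by (auto simp: mem_set_add_iff)
        have "n = b \<odot>\<^bsub>M\<^esub> n"
          using bK K(2) n by auto
        also have "\<dots> = r \<odot>\<^bsub>M\<^esub> (b \<odot>\<^bsub>M\<^esub> m)"
          using lr b m c bL
          by (simp add: smult_r_distr) (metis R.m_comm smult_assoc1)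
        finally have "n \<in> L"
          using submoduleE(4)[OF L lr(2) m(2)] by simp
        then show ?thesis
          using n LN by auto
      qed
      then have "(L <+>\<^bsub>M\<^esub> ?C) \<inter> N = {\<zero>\<^bsub>M\<^esub>}"
        using submodule_zero[OF N] submodule_zero[OF LC(1)] by blast
      then have "L <+>\<^bsub>M\<^esub> ?C = L"
        using Lmax LC by blast
      moreover have "m \<in> ?C"
        using m by (intro image_eqI[of _ _ \<one>]) auto
      ultimately show "m \<in> L"
        using LC(3) by blast
    qed
    then show ?thesis
      using submodule_zero[OF L] submodule_zero[OF submodule_smult_image[OF b]] by blast
  qed
  ultimately have BK: "?B = K"
    using Kmax submodule_smult_image[OF b] by blast
  have "X = {\<zero>\<^bsub>M\<^esub>}" if X: "submodule X R M" "X \<subseteq> K" "N \<inter> X = {\<zero>\<^bsub>M\<^esub>}" for X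
  proof -
    note LX = submodule_set_add[OF L X(1)]
    have "n = \<zero>\<^bsub>M\<^esub>" if n: "n \<in> L <+>\<^bsub>M\<^esub> X" "n \<in> N" for n
    proof -
      obtain l x where lx: "l \<in> L" "x \<in> X" "n = x \<oplus>\<^bsub>M\<^esub> l"
        using n c X(2) M.a_comm unfolding mem_set_add_iff by (metis subsetD)
      then have "l \<in> K"
        using submodule_add_cancel[OF K(1)] n K(2) X(2) c by blast
      then have "l = \<zero>\<^bsub>M\<^esub>"
        using lx KL by blast
      then have "n = x"
        using lx c X(2) by auto
      then show ?thesis
        using lx n X by blast
    qed
    then have "(L <+>\<^bsub>M\<^esub> X) \<inter> N = {\<zero>\<^bsub>M\<^esub>}"
      using submodule_zero[OF N] submodule_zero[OF LX(1)] by blast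
    then have "L <+>\<^bsub>M\<^esub> X = L"
      using Lmax LX by blast
    then show ?thesis
      using LX(3) X KL submodule_zero[OF X(1)] by blast
  qed
  then have "essential_in R M N ?B"
    unfolding BK essential_in_def using N K by blast
  moreover have "b \<odot>\<^bsub>M\<^esub> (b \<odot>\<^bsub>M\<^esub> x) = b \<odot>\<^bsub>M\<^esub> x" if "x \<in> carrier M" for x
    using bK BK that by blast
  ultimately show thesis
    using that b by blast
qed

end


section \<open>Direct summands of a commutative ring\<close>

lemma regular_module_simps [simp]:
  "carrier (regular_module R) = carrier R"
  "smult (regular_module R) = monoid.mult R"
  "\<zero>\<^bsub>regular_module R\<^esub> = \<zero>\<^bsub>R\<^esub>"
  "ring.add (regular_module R) = ring.add R"
  by (simp_all add: regular_module_def)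

context cring
begin

lemma regular_module: "module R (regular_module R)"
  using is_cring by (rule regular_module_is_module)

lemma regular_set_add: "K <+>\<^bsub>regular_module R\<^esub> L = K <+> L"
  by (simp add: set_add_def')

lemma mult_left_minus_one:
  assumes "e \<in> carrier R" "r \<in> carrier R"
  shows "(\<one> \<ominus> e) \<otimes> r = r \<ominus> e \<otimes> r"
  using assms by (simp add: minus_eq l_distr l_minus)

lemma diff_eq_zero_iff:
  assumes "x \<in> carrier R" "y \<in> carrier R"
  shows "x \<ominus> y = \<zero> \<longleftrightarrow> x = y"
  using assms add.inv_solve_right[of x \<zero> y] add.inv_solve_right[of \<zero> x y]
  by (auto simp: minus_eq)

lemma idempotent_complement:
  assumes "e \<in> carrier R" "e \<otimes> e = e"
  shows "(\<one> \<ominus> e) \<otimes> (\<one> \<ominus> e) = \<one> \<ominus> e" "e \<otimes> (\<one> \<ominus> e) = \<zero>"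
proof -
  show *: "e \<otimes> (\<one> \<ominus> e) = \<zero>"
    using assms by (simp add: minus_eq r_distr r_minus r_neg)
  have "(\<one> \<ominus> e) \<otimes> (\<one> \<ominus> e) = (\<one> \<ominus> e) \<ominus> e \<otimes> (\<one> \<ominus> e)"
    using assms by (intro mult_left_minus_one) auto
  also have "\<dots> = \<one> \<ominus> e"
    unfolding * using assms(1) by (simp add: minus_eq)
  finally show "(\<one> \<ominus> e) \<otimes> (\<one> \<ominus> e) = \<one> \<ominus> e" .
qed

lemma idempotent_image_eq_kernel:
  assumes "e \<in> carrier R" "e \<otimes> e = e"
  shows "(\<lambda>x. e \<otimes> x) ` carrier R = {r \<in> carrier R. (\<one> \<ominus> e) \<otimes> r = \<zero>}"
proof (intro equalityI subsetI)
  fix r assume "r \<in> (\<lambda>x. e \<otimes> x) ` carrier R"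
  then have "r \<in> carrier R" "e \<otimes> r = r"
    using assms by (auto simp: m_assoc[symmetric])
  then show "r \<in> {r \<in> carrier R. (\<one> \<ominus> e) \<otimes> r = \<zero>}"
    using assms by (simp add: mult_left_minus_one diff_eq_zero_iff)
next
  fix r assume "r \<in> {r \<in> carrier R. (\<one> \<ominus> e) \<otimes> r = \<zero>}"
  then have "r \<in> carrier R" "r = e \<otimes> r"
    using assms by (auto simp: mult_left_minus_one diff_eq_zero_iff)
  then show "r \<in> (\<lambda>x. e \<otimes> x) ` carrier R"
    by blast
qed

lemma direct_summand_idempotent_image:
  assumes "e \<in> carrier R" "e \<otimes> e = e"
  shows "direct_summand R (regular_module R) ((\<lambda>x. e \<otimes> x) ` carrier R)"
proof -
  interpret A: module R "regular_module R" by (rule regular_module)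
  let ?K = "(\<lambda>x. e \<otimes> x) ` carrier R" and ?L = "(\<lambda>x. (\<one> \<ominus> e) \<otimes> x) ` carrier R"
  have "submodule ?K R (regular_module R)" "submodule ?L R (regular_module R)"
    using A.submodule_smult_image[of e] A.submodule_smult_image[of "\<one> \<ominus> e"] assms by simp_all
  moreover have "?K \<inter> ?L = {\<zero>}"
  proof -
    have "r = \<zero>" if K: "r \<in> ?K" and L: "r \<in> ?L" for r
    proof -
      have "r \<in> carrier R" "(\<one> \<ominus> e) \<otimes> r = \<zero>"
        using K unfolding idempotent_image_eq_kernel[OF assms] by auto
      moreover obtain y where "y \<in> carrier R" "r = (\<one> \<ominus> e) \<otimes> y"
        using L by blast
      then have "(\<one> \<ominus> e) \<otimes> r = r"
        using idempotent_complement(1)[OF assms] assms(1) by (metis m_assoc minus_closed one_closed)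
      ultimately show ?thesis by simp
    qed
    moreover have "\<zero> \<in> ?K" "\<zero> \<in> ?L"
      using A.submodule_zero[OF \<open>submodule ?K R _\<close>] A.submodule_zero[OF \<open>submodule ?L R _\<close>]
      by simp_all
    ultimately show ?thesis
      by blast
  qed
  moreover have "?K <+>\<^bsub>regular_module R\<^esub> ?L = carrier R"
  proof (intro equalityI subsetI)
    fix r assume r: "r \<in> carrier R"
    moreover from this have "r = e \<otimes> r \<oplus> (\<one> \<ominus> e) \<otimes> r"
      unfolding mult_left_minus_one[OF assms(1) \<open>r \<in> carrier R\<close>]
      using assms by (simp add: minus_eq a_lcomm r_neg)
    ultimately show "r \<in> ?K <+>\<^bsub>regular_module R\<^esub> ?L"
      unfolding A.mem_set_add_iff regular_module_simps
      by (intro bexI[of _ "e \<otimes> r"] bexI[of _ "(\<one> \<ominus> e) \<otimes> r"] imageI)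
  qed (use assms in \<open>auto simp: regular_set_add set_add_def'\<close>)
  ultimately show ?thesis
    unfolding direct_summand_def by auto
qed

text \<open>If \<open>R = K \<oplus> L\<close> and \<open>1 = e + l\<close> accordingly, then \<open>e\<close> acts as the projection onto \<open>K\<close>, since
  \<open>x = ex + lx\<close> and \<open>lx \<in> K \<inter> L\<close> for \<open>x \<in> K\<close>.\<close>

lemma direct_summand_regular_iff:
  "direct_summand R (regular_module R) K \<longleftrightarrow>
    (\<exists>e\<in>carrier R. e \<otimes> e = e \<and> K = (\<lambda>x. e \<otimes> x) ` carrier R)"
proof
  assume "direct_summand R (regular_module R) K"
  interpret A: module R "regular_module R" by (rule regular_module)
  from \<open>direct_summand R (regular_module R) K\<close> obtain L
    where K: "submodule K R (regular_module R)" and L: "submodule L R (regular_module R)"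
    and KL: "K \<inter> L = {\<zero>}" and sum: "K <+> L = carrier R"
    by (auto simp: direct_summand_def regular_set_add)
  note c = subsetD[OF A.submoduleE(1)[OF K], simplified] subsetD[OF A.submoduleE(1)[OF L], simplified]
  obtain e l where el: "e \<in> K" "l \<in> L" "\<one> = e \<oplus> l"
    using one_closed unfolding sum[symmetric] set_add_def' by auto
  have fix_K: "e \<otimes> x = x" if x: "x \<in> K" for x
  proof -
    have x_eq: "x = e \<otimes> x \<oplus> l \<otimes> x"
      using el c x by (metis l_distr l_one)
    have "e \<otimes> x \<in> K" "x \<otimes> l \<in> L"
      using A.submoduleE(4)[OF K, of e x] A.submoduleE(4)[OF L, of x l] el c x by auto
    moreover have "x \<otimes> l = l \<otimes> x"
      using c el x by (simp add: m_comm)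
    moreover have "l \<otimes> x \<in> K"
      using A.submodule_add_cancel[OF K, of "e \<otimes> x" "l \<otimes> x"] x_eq x calculation(1) c el by simp
    ultimately have "l \<otimes> x = \<zero>"
      using KL by auto
    then show ?thesis
      using x_eq c el x by simp
  qed
  have "K = (\<lambda>x. e \<otimes> x) ` carrier R"
  proof (intro equalityI subsetI)
    fix x assume "x \<in> K"
    then show "x \<in> (\<lambda>x. e \<otimes> x) ` carrier R"
      using fix_K c by (intro image_eqI[of _ _ x]) auto
  next
    fix x assume "x \<in> (\<lambda>x. e \<otimes> x) ` carrier R"
    then show "x \<in> K"
      using A.submoduleE(4)[OF K] el c m_comm by auto
  qed
  then show "\<exists>e\<in>carrier R. e \<otimes> e = e \<and> K = (\<lambda>x. e \<otimes> x) ` carrier R"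
    using fix_K el c by blast
qed (use direct_summand_idempotent_image in blast)

lemma CS_ring_iff_strongly_CS: "CS_ring R \<longleftrightarrow> strongly_CS R (regular_module R)"
  unfolding CS_ring_def CS_module_def strongly_CS_def direct_summand_regular_iff
    regular_module_simps by blast

end

context module
begin

text \<open>The annihilator of \<open>M\<close> is a direct summand \<open>fR\<close> exactly if it is the kernel of an idempotent
  \<open>g = 1 - f\<close>, which then acts as the identity on \<open>M\<close>.\<close>

lemma annihilator_direct_summand_iff:
  "direct_summand R (regular_module R) (annihilator R M (carrier M)) \<longleftrightarrow>
    (\<exists>g\<in>carrier R. g \<otimes> g = g \<and> (\<forall>r\<in>carrier R. r \<in> annihilator R M (carrier M) \<longleftrightarrow> g \<otimes> r = \<zero>))"
proof
  assume "direct_summand R (regular_module R) (annihilator R M (carrier M))"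
  then obtain e where e: "e \<in> carrier R" "e \<otimes> e = e"
    "annihilator R M (carrier M) = (\<lambda>x. e \<otimes> x) ` carrier R"
    unfolding R.direct_summand_regular_iff by blast
  then show "\<exists>g\<in>carrier R. g \<otimes> g = g \<and>
      (\<forall>r\<in>carrier R. r \<in> annihilator R M (carrier M) \<longleftrightarrow> g \<otimes> r = \<zero>)"
    by (intro bexI[of _ "\<one> \<ominus> e"])
       (auto simp: R.idempotent_image_eq_kernel R.idempotent_complement)
next
  assume "\<exists>g\<in>carrier R. g \<otimes> g = g \<and>
      (\<forall>r\<in>carrier R. r \<in> annihilator R M (carrier M) \<longleftrightarrow> g \<otimes> r = \<zero>)"
  then obtain g where g: "g \<in> carrier R" "g \<otimes> g = g"
    and ann: "\<And>r. r \<in> carrier R \<Longrightarrow> r \<in> annihilator R M (carrier M) \<longleftrightarrow> g \<otimes> r = \<zero>"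
    by blast
  have "\<one> \<ominus> (\<one> \<ominus> g) = g"
    using g by (simp add: R.minus_eq R.minus_add R.r_neg2)
  then have "annihilator R M (carrier M) = (\<lambda>x. (\<one> \<ominus> g) \<otimes> x) ` carrier R"
    using g ann by (subst R.idempotent_image_eq_kernel)
      (auto simp: R.idempotent_complement annihilator_def)
  then show "direct_summand R (regular_module R) (annihilator R M (carrier M))"
    using g by (simp add: R.direct_summand_idempotent_image R.idempotent_complement)
qed

lemma smult_eq_if_annihilator:
  assumes g: "g \<in> carrier R" "g \<otimes> g = g"
    and ann: "\<forall>r\<in>carrier R. r \<in> annihilator R M (carrier M) \<longleftrightarrow> g \<otimes> r = \<zero>"
    and x: "x \<in> carrier M"
  shows "g \<odot>\<^bsub>M\<^esub> x = x"
proof -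
  have "\<one> \<ominus> g \<in> annihilator R M (carrier M)"
    using g ann R.idempotent_complement(2)[OF g] by blast
  then have "(\<one> \<ominus> g) \<odot>\<^bsub>M\<^esub> x = \<zero>\<^bsub>M\<^esub>"
    using x by (auto simp: annihilator_def)
  then have "x \<oplus>\<^bsub>M\<^esub> \<ominus>\<^bsub>M\<^esub> (g \<odot>\<^bsub>M\<^esub> x) = \<zero>\<^bsub>M\<^esub>"
    using g x by (simp add: R.minus_eq smult_l_distr smult_l_minus)
  then show ?thesis
    using g x by (metis M.minus_equality M.minus_minus M.a_inv_closed M.a_comm smult_closed)
qed

text \<open>The projection \<open>b\<close> provided by the weakly IN property satisfies \<open>b\<^sup>2 - b \<in> Ann M\<close> only. Multiplying
  it with the idempotent \<open>g\<close> whose kernel is \<open>Ann M\<close> makes it idempotent in \<open>R\<close> and leaves its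
  action on \<open>M\<close> unchanged.\<close>

lemma weakly_IN_imp_strongly_CS:
  assumes IN: "weakly_IN R M"
    and ds: "direct_summand R (regular_module R) (annihilator R M (carrier M))"
  shows "strongly_CS R M"
  unfolding strongly_CS_def
proof (intro allI impI)
  fix N assume N: "submodule N R M"
  obtain b where b: "b \<in> carrier R"
    and proj: "\<And>x. x \<in> carrier M \<Longrightarrow> b \<odot>\<^bsub>M\<^esub> (b \<odot>\<^bsub>M\<^esub> x) = b \<odot>\<^bsub>M\<^esub> x"
    and ess: "essential_in R M N ((\<lambda>x. b \<odot>\<^bsub>M\<^esub> x) ` carrier M)"
    using weakly_IN_imp_projection[OF IN N] by metis
  obtain g where g: "g \<in> carrier R" "g \<otimes> g = g"
    and ann: "\<forall>r\<in>carrier R. r \<in> annihilator R M (carrier M) \<longleftrightarrow> g \<otimes> r = \<zero>"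
    using ds unfolding annihilator_direct_summand_iff by blast
  have "b \<otimes> b \<ominus> b \<in> annihilator R M (carrier M)"
    using b proj by (simp add: annihilator_def R.minus_eq smult_l_distr smult_l_minus smult_assoc1 M.r_neg)
  then have "g \<otimes> (b \<otimes> b \<ominus> b) = \<zero>"
    using ann b by blast
  then have gbb: "g \<otimes> (b \<otimes> b) = g \<otimes> b"
    using b g by (simp add: R.minus_eq R.r_distr R.r_minus)
      (metis R.add.inv_closed R.minus_equality R.minus_minus R.m_closed R.a_comm)
  have "g \<otimes> b \<otimes> (g \<otimes> b) = g \<otimes> g \<otimes> (b \<otimes> b)"
    using b g(1) by (simp add: R.m_ac)
  also have "\<dots> = g \<otimes> b"
    using g gbb by simp
  finally have "g \<otimes> b \<otimes> (g \<otimes> b) = g \<otimes> b" .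
  moreover have "(g \<otimes> b) \<odot>\<^bsub>M\<^esub> x = b \<odot>\<^bsub>M\<^esub> x" if "x \<in> carrier M" for x
    using that b g smult_eq_if_annihilator[OF g ann] by (simp add: smult_assoc1)
  then have "(\<lambda>x. (g \<otimes> b) \<odot>\<^bsub>M\<^esub> x) ` carrier M = (\<lambda>x. b \<odot>\<^bsub>M\<^esub> x) ` carrier M"
    by (intro image_cong) auto
  ultimately show "\<exists>e\<in>carrier R. e \<otimes> e = e \<and> essential_in R M N ((\<lambda>x. e \<odot>\<^bsub>M\<^esub> x) ` carrier M)"
    using ess b g(1) by (intro bexI[of _ "g \<otimes> b"]) auto
qed

end

text \<open>A ring is faithful over itself: its annihilator is zero, the kernel of the idempotent \<open>1\<close>.\<close>

lemma (in cring) regular_weakly_IN_imp_strongly_CS: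
  assumes "weakly_IN R (regular_module R)"
  shows "strongly_CS R (regular_module R)"
proof -
  interpret A: module R "regular_module R" by (rule regular_module)
  have "r \<in> annihilator R (regular_module R) (carrier R) \<longleftrightarrow> \<one> \<otimes> r = \<zero>" if "r \<in> carrier R" for r
    using that by (auto simp: annihilator_def dest: bspec[OF _ one_closed])
  then have "direct_summand R (regular_module R)
      (annihilator R (regular_module R) (carrier (regular_module R)))"
    unfolding A.annihilator_direct_summand_iff by (intro bexI[of _ \<one>]) auto
  then show ?thesis
    by (rule A.weakly_IN_imp_strongly_CS[OF assms])
qed


section \<open>Idempotents and ideals of a trivial extension\<close>

lemma trivial_extension_simps [simp]:
  "carrier (trivial_extension R M) = carrier R \<times> carrier M"
  "(a, x) \<otimes>\<^bsub>trivial_extension R M\<^esub> (b, y) = (a \<otimes>\<^bsub>R\<^esub> b, a \<odot>\<^bsub>M\<^esub> y \<oplus>\<^bsub>M\<^esub> b \<odot>\<^bsub>M\<^esub> x)"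
  "(a, x) \<oplus>\<^bsub>trivial_extension R M\<^esub> (b, y) = (a \<oplus>\<^bsub>R\<^esub> b, x \<oplus>\<^bsub>M\<^esub> y)"
  "\<one>\<^bsub>trivial_extension R M\<^esub> = (\<one>\<^bsub>R\<^esub>, \<zero>\<^bsub>M\<^esub>)"
  "\<zero>\<^bsub>trivial_extension R M\<^esub> = (\<zero>\<^bsub>R\<^esub>, \<zero>\<^bsub>M\<^esub>)"
  by (simp_all add: trivial_extension_def)

context module
begin

abbreviation A where "A \<equiv> trivial_extension R M"

abbreviation regular_A where "regular_A \<equiv> regular_module (trivial_extension R M)"

lemma trivial_extension_cring: "cring A"
  by (rule trivial_extension_is_cring) (rule module_axioms)

lemma regular_A_module: "module A regular_A"
  using trivial_extension_cring by (rule regular_module_is_module)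

text \<open>From \<open>(e, x)\<^sup>2 = (e, x)\<close> it follows that \<open>x = 2ex\<close>; multiplying with \<open>e\<close> gives \<open>ex = 0\<close>, and then
  \<open>x = 0\<close>.\<close>

lemma trivial_extension_idempotent:
  assumes "p \<in> carrier A" "p \<otimes>\<^bsub>A\<^esub> p = p"
  obtains e where "e \<in> carrier R" "e \<otimes> e = e" "p = (e, \<zero>\<^bsub>M\<^esub>)"
proof -
  obtain e x where p: "p = (e, x)" "e \<in> carrier R" "x \<in> carrier M"
    using assms(1) by auto
  then have e: "e \<otimes> e = e" and x: "e \<odot>\<^bsub>M\<^esub> x \<oplus>\<^bsub>M\<^esub> e \<odot>\<^bsub>M\<^esub> x = x"
    using assms(2) by auto
  have "e \<odot>\<^bsub>M\<^esub> x \<oplus>\<^bsub>M\<^esub> e \<odot>\<^bsub>M\<^esub> x = e \<odot>\<^bsub>M\<^esub> (e \<odot>\<^bsub>M\<^esub> x \<oplus>\<^bsub>M\<^esub> e \<odot>\<^bsub>M\<^esub> x)"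
    using p e by (simp add: smult_r_distr smult_assoc1[symmetric])
  also have "\<dots> = e \<odot>\<^bsub>M\<^esub> x"
    unfolding x ..
  finally have "e \<odot>\<^bsub>M\<^esub> x = \<zero>\<^bsub>M\<^esub>"
    using p by (metis M.add.r_cancel_one smult_closed)
  then show thesis
    using that p e x by auto
qed

lemma trivial_extension_idempotent_image:
  assumes "e \<in> carrier R"
  shows "(\<lambda>p. (e, \<zero>\<^bsub>M\<^esub>) \<otimes>\<^bsub>A\<^esub> p) ` carrier A =
    ((\<lambda>r. e \<otimes> r) ` carrier R) \<times> ((\<lambda>x. e \<odot>\<^bsub>M\<^esub> x) ` carrier M)"
proof -
  have "(\<lambda>p. (e, \<zero>\<^bsub>M\<^esub>) \<otimes>\<^bsub>A\<^esub> p) ` carrier A =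
      (\<lambda>(r, x). (e \<otimes> r, e \<odot>\<^bsub>M\<^esub> x)) ` (carrier R \<times> carrier M)"
    using assms by (intro image_cong) auto
  then show ?thesis
    by auto
qed

lemma submodule_trivial_extension_Times:
  assumes J: "submodule J R (regular_module R)" and N: "submodule N R M"
    and JN: "\<And>r x. r \<in> J \<Longrightarrow> x \<in> carrier M \<Longrightarrow> r \<odot>\<^bsub>M\<^esub> x \<in> N"
  shows "submodule (J \<times> N) A regular_A"
proof -
  interpret R': module R "regular_module R" by (rule R.regular_module)
  interpret A': module A regular_A by (rule regular_A_module)
  note c = subsetD[OF R'.submoduleE(1)[OF J]] subsetD[OF submoduleE(1)[OF N]]
  show ?thesis
  proof (rule A'.submodule_if_add_smult_closed)
    show "J \<times> N \<subseteq> carrier regular_A"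
      using c by auto
    show "\<zero>\<^bsub>regular_A\<^esub> \<in> J \<times> N"
      using R'.submodule_zero[OF J] submodule_zero[OF N] by simp
    show "p \<oplus>\<^bsub>regular_A\<^esub> q \<in> J \<times> N" if "p \<in> J \<times> N" "q \<in> J \<times> N" for p q
      using that R'.submoduleE(5)[OF J] submoduleE(5)[OF N] by auto
    show "q \<odot>\<^bsub>regular_A\<^esub> p \<in> J \<times> N" if "q \<in> carrier A" "p \<in> J \<times> N" for p q
      using that R'.submoduleE(4)[OF J] submoduleE(4)[OF N] submoduleE(5)[OF N] JN by auto
  qed
qed

lemma submodule_trivial_extension_snd:
  assumes I: "submodule I A regular_A"
  shows "submodule {x \<in> carrier M. (\<zero>, x) \<in> I} R M"
proof -
  interpret A': module A regular_A by (rule regular_A_module)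
  show ?thesis
  proof (rule submodule_if_add_smult_closed)
    show "\<zero>\<^bsub>M\<^esub> \<in> {x \<in> carrier M. (\<zero>, x) \<in> I}"
      using A'.submodule_zero[OF I] by simp
    show "x \<oplus>\<^bsub>M\<^esub> y \<in> {x \<in> carrier M. (\<zero>, x) \<in> I}"
      if "x \<in> {x \<in> carrier M. (\<zero>, x) \<in> I}" "y \<in> {x \<in> carrier M. (\<zero>, x) \<in> I}" for x y
      using that A'.submoduleE(5)[OF I, of "(\<zero>, x)" "(\<zero>, y)"] by simp
    show "r \<odot>\<^bsub>M\<^esub> x \<in> {x \<in> carrier M. (\<zero>, x) \<in> I}"
      if "r \<in> carrier R" "x \<in> {x \<in> carrier M. (\<zero>, x) \<in> I}" for r x
      using that A'.submoduleE(4)[OF I, of "(r, \<zero>\<^bsub>M\<^esub>)" "(\<zero>, x)"] by simp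
  qed auto
qed

lemma submodule_trivial_extension_fst:
  assumes I: "submodule I A regular_A" and g: "g \<in> carrier R"
  shows "submodule {r \<in> carrier R. (r, \<zero>\<^bsub>M\<^esub>) \<in> I \<and> g \<otimes> r = \<zero>} R (regular_module R)"
    (is "submodule ?K _ _")
proof -
  interpret R': module R "regular_module R" by (rule R.regular_module)
  interpret A': module A regular_A by (rule regular_A_module)
  show ?thesis
  proof (rule R'.submodule_if_add_smult_closed)
    show "\<zero>\<^bsub>regular_module R\<^esub> \<in> ?K"
      using A'.submodule_zero[OF I] g by simp
    show "r \<oplus>\<^bsub>regular_module R\<^esub> s \<in> ?K" if "r \<in> ?K" "s \<in> ?K" for r s
      using that A'.submoduleE(5)[OF I, of "(r, \<zero>\<^bsub>M\<^esub>)" "(s, \<zero>\<^bsub>M\<^esub>)"] g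
      by (simp add: R.r_distr)
    show "s \<odot>\<^bsub>regular_module R\<^esub> r \<in> ?K" if "s \<in> carrier R" "r \<in> ?K" for r s
      using that A'.submoduleE(4)[OF I, of "(s, \<zero>\<^bsub>M\<^esub>)" "(r, \<zero>\<^bsub>M\<^esub>)"] g
      by (simp add: R.m_lcomm[of g s r])
  qed auto
qed


section \<open>From the trivial extension to the base ring and the module\<close>

lemma trivial_extension_strongly_CSE:
  assumes "strongly_CS A regular_A" "submodule I A regular_A"
  obtains e where "e \<in> carrier R" "e \<otimes> e = e"
    "essential_in A regular_A I (((\<lambda>r. e \<otimes> r) ` carrier R) \<times> ((\<lambda>x. e \<odot>\<^bsub>M\<^esub> x) ` carrier M))"
proof -
  obtain p where p: "p \<in> carrier A" "p \<otimes>\<^bsub>A\<^esub> p = p"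
    "essential_in A regular_A I ((\<lambda>q. p \<otimes>\<^bsub>A\<^esub> q) ` carrier A)"
    using assms unfolding strongly_CS_def regular_module_simps by blast
  then obtain e where e: "e \<in> carrier R" "e \<otimes> e = e" "p = (e, \<zero>\<^bsub>M\<^esub>)"
    using trivial_extension_idempotent by blast
  show thesis
    using that[OF e(1,2)] p(3) unfolding e(3) trivial_extension_idempotent_image[OF e(1)] .
qed

text \<open>Multiples of \<open>(0, x)\<close> in \<open>A\<close> are the pairs \<open>(0, rx)\<close>, so essentiality of \<open>0 \<times> N\<close> passes to the
  second component. The extension inside \<open>A\<close> is kept as well, since for \<open>N = M\<close> it determines the
  annihilator of \<open>M\<close>.\<close>

lemma trivial_extension_zero_Times_essential:
  assumes CS: "strongly_CS A regular_A" and N: "submodule N R M"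
  obtains e where "e \<in> carrier R" "e \<otimes> e = e"
    "essential_in R M N ((\<lambda>x. e \<odot>\<^bsub>M\<^esub> x) ` carrier M)"
    "essential_in A regular_A ({\<zero>} \<times> N) (((\<lambda>r. e \<otimes> r) ` carrier R) \<times> ((\<lambda>x. e \<odot>\<^bsub>M\<^esub> x) ` carrier M))"
proof -
  interpret R': module R "regular_module R" by (rule R.regular_module)
  interpret A': module A regular_A by (rule regular_A_module)
  have "submodule ({\<zero>} \<times> N) A regular_A"
    using R'.submodule_zero_set N submodule_zero[OF N]
    by (intro submodule_trivial_extension_Times) auto
  then obtain e where e: "e \<in> carrier R" "e \<otimes> e = e"
    and ess: "essential_in A regular_A ({\<zero>} \<times> N)
      (((\<lambda>r. e \<otimes> r) ` carrier R) \<times> ((\<lambda>x. e \<odot>\<^bsub>M\<^esub> x) ` carrier M))"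
    using trivial_extension_strongly_CSE[OF CS] by blast
  have "N \<subseteq> (\<lambda>x. e \<odot>\<^bsub>M\<^esub> x) ` carrier M"
    using ess by (auto simp: A'.essential_in_iff)
  moreover have "\<exists>r\<in>carrier R. r \<odot>\<^bsub>M\<^esub> x \<in> N \<and> r \<odot>\<^bsub>M\<^esub> x \<noteq> \<zero>\<^bsub>M\<^esub>"
    if x: "x \<in> (\<lambda>x. e \<odot>\<^bsub>M\<^esub> x) ` carrier M" "x \<noteq> \<zero>\<^bsub>M\<^esub>" for x
  proof -
    have "\<zero> \<in> (\<lambda>r. e \<otimes> r) ` carrier R"
      using e by (intro image_eqI[of _ _ \<zero>]) auto
    moreover have xM: "x \<in> carrier M"
      using x e by auto
    ultimately obtain q where q: "q \<in> carrier A"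
      "q \<odot>\<^bsub>regular_A\<^esub> (\<zero>, x) \<in> {\<zero>} \<times> N" "q \<odot>\<^bsub>regular_A\<^esub> (\<zero>, x) \<noteq> \<zero>\<^bsub>regular_A\<^esub>"
      using A'.essential_inE[OF ess, of "(\<zero>, x)"] x by auto
    then obtain r y where "q = (r, y)" "r \<in> carrier R" "y \<in> carrier M"
      by auto
    then show ?thesis
      using q xM by (intro bexI[of _ r]) auto
  qed
  ultimately have "essential_in R M N ((\<lambda>x. e \<odot>\<^bsub>M\<^esub> x) ` carrier M)"
    unfolding essential_in_iff using N submodule_smult_image[OF e(1)] by blast
  then show thesis
    using that e ess by blast
qed

lemma strongly_CS_if_trivial_extension:
  assumes "strongly_CS A regular_A"
  shows "strongly_CS R M"
  unfolding strongly_CS_def using trivial_extension_zero_Times_essential[OF assms] by metis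

text \<open>Let \<open>0 \<times> M\<close> be essential in \<open>eR \<times> eM\<close>. Then \<open>e\<close> acts as the identity on \<open>M\<close>, and \<open>eR \<inter> Ann M = 0\<close>
  because an element of this intersection generates an ideal that avoids \<open>0 \<times> M\<close>. Hence \<open>Ann M\<close>
  is the kernel of \<open>e\<close>.\<close>

lemma annihilator_direct_summand_if_trivial_extension:
  assumes "strongly_CS A regular_A"
  shows "direct_summand R (regular_module R) (annihilator R M (carrier M))"
  unfolding annihilator_direct_summand_iff
proof -
  interpret A': module A regular_A by (rule regular_A_module)
  obtain e where e: "e \<in> carrier R" "e \<otimes> e = e"
    and essM: "essential_in R M (carrier M) ((\<lambda>x. e \<odot>\<^bsub>M\<^esub> x) ` carrier M)"
    and ess: "essential_in A regular_A ({\<zero>} \<times> carrier M)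
      (((\<lambda>r. e \<otimes> r) ` carrier R) \<times> ((\<lambda>x. e \<odot>\<^bsub>M\<^esub> x) ` carrier M))"
    using trivial_extension_zero_Times_essential[OF assms carrier_is_submodule] by blast
  have eM: "e \<odot>\<^bsub>M\<^esub> x = x" if "x \<in> carrier M" for x
    using that essM smult_idempotent[OF e] unfolding essential_in_iff by blast
  have "e \<otimes> r = \<zero>" if r: "r \<in> annihilator R M (carrier M)" for r
  proof (rule ccontr)
    assume nz: "e \<otimes> r \<noteq> \<zero>"
    have rR: "r \<in> carrier R" and rM: "\<And>x. x \<in> carrier M \<Longrightarrow> r \<odot>\<^bsub>M\<^esub> x = \<zero>\<^bsub>M\<^esub>"
      using r by (auto simp: annihilator_def)
    have "\<zero>\<^bsub>M\<^esub> \<in> (\<lambda>x. e \<odot>\<^bsub>M\<^esub> x) ` carrier M"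
      using e by (intro image_eqI[of _ _ "\<zero>\<^bsub>M\<^esub>"]) auto
    then obtain q where q: "q \<in> carrier A"
      "q \<odot>\<^bsub>regular_A\<^esub> (e \<otimes> r, \<zero>\<^bsub>M\<^esub>) \<in> {\<zero>} \<times> carrier M"
      "q \<odot>\<^bsub>regular_A\<^esub> (e \<otimes> r, \<zero>\<^bsub>M\<^esub>) \<noteq> \<zero>\<^bsub>regular_A\<^esub>"
      using A'.essential_inE[OF ess, of "(e \<otimes> r, \<zero>\<^bsub>M\<^esub>)"] nz rR by auto
    then obtain s y where "q = (s, y)" "s \<in> carrier R" "y \<in> carrier M"
      by auto
    then show False
      using q rR rM e by (auto simp: smult_assoc1)
  qed
  moreover have "r \<in> annihilator R M (carrier M)" if "r \<in> carrier R" "e \<otimes> r = \<zero>" for r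
  proof -
    have "r \<odot>\<^bsub>M\<^esub> x = \<zero>\<^bsub>M\<^esub>" if "x \<in> carrier M" for x
    proof -
      have "r \<odot>\<^bsub>M\<^esub> x = e \<odot>\<^bsub>M\<^esub> (r \<odot>\<^bsub>M\<^esub> x)"
        using eM \<open>r \<in> carrier R\<close> that by simp
      also have "\<dots> = \<zero>\<^bsub>M\<^esub>"
        using e \<open>r \<in> carrier R\<close> \<open>e \<otimes> r = \<zero>\<close> that by (simp add: smult_assoc1[symmetric])
      finally show ?thesis .
    qed
    then show ?thesis
      using that by (auto simp: annihilator_def)
  qed
  ultimately show "\<exists>g\<in>carrier R. g \<otimes> g = g \<and>
      (\<forall>r\<in>carrier R. r \<in> annihilator R M (carrier M) \<longleftrightarrow> g \<otimes> r = \<zero>)"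
    using e by blast
qed


end


section \<open>Tensor relations\<close>

lemma tensor_rels_add:
  assumes "module R N" "module R M" "z \<in> tensor_rels R N M" "z' \<in> tensor_rels R N M"
  shows "z + z' \<in> tensor_rels R N M"
  using subgroup.m_closed[OF subgroup_tensor_rels[OF assms(1,2)] assms(3,4)] by simp

lemma tensor_rels_uminus_iff:
  assumes "module R N" "module R M"
  shows "- z \<in> tensor_rels R N M \<longleftrightarrow> z \<in> tensor_rels R N M"
proof -
  note sg = subgroup_tensor_rels[OF assms]
  have "- z \<in> tensor_rels R N M" if "z \<in> tensor_rels R N M" for z
  proof -
    have "Poly_Mapping.keys z \<subseteq> carrier N \<times> carrier M"
      using subgroup.mem_carrier[OF sg that] by simp
    then show ?thesis
      using subgroup.m_inv_closed[OF sg that] by simp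
  qed
  from this[of z] this[of "- z"] show ?thesis
    by auto
qed

lemma frag_of_smult_in_tensor_rels_iff:
  assumes "module R N" "module R M" "r \<in> carrier R" "n \<in> carrier N" "x \<in> carrier M"
  shows "frag_of (r \<odot>\<^bsub>N\<^esub> n, x) \<in> tensor_rels R N M \<longleftrightarrow> frag_of (n, r \<odot>\<^bsub>M\<^esub> x) \<in> tensor_rels R N M"
proof -
  have *: "frag_of (r \<odot>\<^bsub>N\<^esub> n, x) - frag_of (n, r \<odot>\<^bsub>M\<^esub> x) \<in> tensor_rels R N M" (is "?u - ?v \<in> _")
    unfolding tensor_rels_def using assms(3-5) by (intro generate.incl UnI2) blast
  then have "?v - ?u \<in> tensor_rels R N M"
    using tensor_rels_uminus_iff[OF assms(1,2), of "?u - ?v"] by simp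
  with * show ?thesis
    using tensor_rels_add[OF assms(1,2) *, of ?v] tensor_rels_add[OF assms(1,2), of "?v - ?u" ?u]
    by auto
qed

lemma frag_of_add_in_tensor_rels:
  assumes "module R N" "module R M" "n \<in> carrier N" "x \<in> carrier M" "y \<in> carrier M"
    and "frag_of (n, x) \<in> tensor_rels R N M" "frag_of (n, y) \<in> tensor_rels R N M"
  shows "frag_of (n, x \<oplus>\<^bsub>M\<^esub> y) \<in> tensor_rels R N M"
proof -
  have "frag_of (n, x \<oplus>\<^bsub>M\<^esub> y) - frag_of (n, x) - frag_of (n, y) \<in> tensor_rels R N M"
    unfolding tensor_rels_def using assms(3-5) by (intro generate.incl UnI1[OF UnI2]) blast
  from tensor_rels_add[OF assms(1,2) tensor_rels_add[OF assms(1,2) this assms(7)] assms(6)]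
  show ?thesis
    by simp
qed

lemma frag_of_zero_in_tensor_rels:
  assumes "module R N" "module R M" "x \<in> carrier M"
  shows "frag_of (\<zero>\<^bsub>N\<^esub>, x) \<in> tensor_rels R N M"
proof -
  interpret N: module R N by fact
  have "frag_of (\<zero>\<^bsub>N\<^esub> \<oplus>\<^bsub>N\<^esub> \<zero>\<^bsub>N\<^esub>, x) - frag_of (\<zero>\<^bsub>N\<^esub>, x) - frag_of (\<zero>\<^bsub>N\<^esub>, x) \<in> tensor_rels R N M"
    unfolding tensor_rels_def using assms(3) by (intro generate.incl UnI1[OF UnI1]) blast
  then show ?thesis
    using tensor_rels_uminus_iff[OF assms(1,2), of "frag_of (\<zero>\<^bsub>N\<^esub>, x)"] by simp
qed

text \<open>A balanced biadditive map \<open>\<beta>\<close> on \<open>N \<times> M\<close> extends to the free abelian group, and the extension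
  kills all tensor relations. So \<open>\<beta> n x = 0\<close> whenever \<open>n \<otimes> x = 0\<close>.\<close>

lemma balanced_map_eq_zero_if_in_tensor_rels:
  assumes "module R N" "module R M" "comm_group H"
    and closed: "\<And>n x. n \<in> carrier N \<Longrightarrow> x \<in> carrier M \<Longrightarrow> \<beta> n x \<in> carrier H"
    and add_left: "\<And>n n' x. n \<in> carrier N \<Longrightarrow> n' \<in> carrier N \<Longrightarrow> x \<in> carrier M \<Longrightarrow>
      \<beta> (n \<oplus>\<^bsub>N\<^esub> n') x = \<beta> n x \<otimes>\<^bsub>H\<^esub> \<beta> n' x"
    and add_right: "\<And>n x x'. n \<in> carrier N \<Longrightarrow> x \<in> carrier M \<Longrightarrow> x' \<in> carrier M \<Longrightarrow>
      \<beta> n (x \<oplus>\<^bsub>M\<^esub> x') = \<beta> n x \<otimes>\<^bsub>H\<^esub> \<beta> n x'"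
    and balanced: "\<And>r n x. r \<in> carrier R \<Longrightarrow> n \<in> carrier N \<Longrightarrow> x \<in> carrier M \<Longrightarrow>
      \<beta> (r \<odot>\<^bsub>N\<^esub> n) x = \<beta> n (r \<odot>\<^bsub>M\<^esub> x)"
    and nx: "n \<in> carrier N" "x \<in> carrier M" "frag_of (n, x) \<in> tensor_rels R N M"
  shows "\<beta> n x = \<one>\<^bsub>H\<^esub>"
proof -
  interpret N: module R N by fact
  interpret M: module R M by fact
  interpret H: comm_group H by fact
  let ?F = "free_Abelian_group (carrier N \<times> carrier M)"
  obtain h where h: "h \<in> hom ?F H"
    and h_frag: "\<And>z. z \<in> carrier N \<times> carrier M \<Longrightarrow> h (frag_of z) = case_prod \<beta> z"
  proof (rule H.free_Abelian_group_universal)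
    show "case_prod \<beta> ` (carrier N \<times> carrier M) \<subseteq> carrier H"
      using closed by auto
  qed (rule that)
  interpret F: group ?F by (rule group_free_Abelian_group)
  interpret h: group_hom ?F H h
    using h by unfold_locales
  have h_diff: "h (u - v) = h u \<otimes>\<^bsub>H\<^esub> inv\<^bsub>H\<^esub> h v" "u - v \<in> carrier ?F"
    if "u \<in> carrier ?F" "v \<in> carrier ?F" for u v
  proof -
    have "- v \<in> carrier ?F" "h (- v) = inv\<^bsub>H\<^esub> h v"
      using h.hom_inv[OF that(2)] that(2) by simp_all
    then show "h (u - v) = h u \<otimes>\<^bsub>H\<^esub> inv\<^bsub>H\<^esub> h v" "u - v \<in> carrier ?F"
      using h.hom_mult[OF that(1), of "- v"] F.m_closed[OF that(1), of "- v"] by simp_all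
  qed
  have frag: "frag_of (n, x) \<in> carrier ?F" "h (frag_of (n, x)) = \<beta> n x"
    if "n \<in> carrier N" "x \<in> carrier M" for n x
    using that h_frag[of "(n, x)"] by auto
  have "tensor_rels R N M \<subseteq> kernel ?F H h"
    unfolding tensor_rels_def
  proof (rule F.generate_subgroup_incl[OF _ h.subgroup_kernel], intro Un_least subsetI)
    fix u assume "u \<in> {frag_of (n \<oplus>\<^bsub>N\<^esub> n', x) - frag_of (n, x) - frag_of (n', x) | n n' x.
        n \<in> carrier N \<and> n' \<in> carrier N \<and> x \<in> carrier M}"
    then obtain n n' x where u: "u = frag_of (n \<oplus>\<^bsub>N\<^esub> n', x) - frag_of (n, x) - frag_of (n', x)"
      and c: "n \<in> carrier N" "n' \<in> carrier N" "x \<in> carrier M"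
      by blast
    have "h u = \<beta> n x \<otimes>\<^bsub>H\<^esub> \<beta> n' x \<otimes>\<^bsub>H\<^esub> inv\<^bsub>H\<^esub> \<beta> n x \<otimes>\<^bsub>H\<^esub> inv\<^bsub>H\<^esub> \<beta> n' x"
      unfolding u using c by (simp only: h_diff frag N.M.add.m_closed add_left simp_thms)
    also have "\<dots> = \<one>\<^bsub>H\<^esub>"
      using closed c by (simp add: H.m_assoc H.m_lcomm[of "\<beta> n' x"])
    finally show "u \<in> kernel ?F H h"
      using c unfolding u kernel_def by (simp only: h_diff frag N.M.add.m_closed mem_Collect_eq simp_thms)
  next
    fix u assume "u \<in> {frag_of (n, x \<oplus>\<^bsub>M\<^esub> x') - frag_of (n, x) - frag_of (n, x') | n x x'.
        n \<in> carrier N \<and> x \<in> carrier M \<and> x' \<in> carrier M}"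
    then obtain n x x' where u: "u = frag_of (n, x \<oplus>\<^bsub>M\<^esub> x') - frag_of (n, x) - frag_of (n, x')"
      and c: "n \<in> carrier N" "x \<in> carrier M" "x' \<in> carrier M"
      by blast
    have "h u = \<beta> n x \<otimes>\<^bsub>H\<^esub> \<beta> n x' \<otimes>\<^bsub>H\<^esub> inv\<^bsub>H\<^esub> \<beta> n x \<otimes>\<^bsub>H\<^esub> inv\<^bsub>H\<^esub> \<beta> n x'"
      unfolding u using c by (simp only: h_diff frag M.M.add.m_closed add_right simp_thms)
    also have "\<dots> = \<one>\<^bsub>H\<^esub>"
      using closed c by (simp add: H.m_assoc H.m_lcomm[of "\<beta> n x'"])
    finally show "u \<in> kernel ?F H h"
      using c unfolding u kernel_def by (simp only: h_diff frag M.M.add.m_closed mem_Collect_eq simp_thms)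
  next
    fix u assume "u \<in> {frag_of (r \<odot>\<^bsub>N\<^esub> n, x) - frag_of (n, r \<odot>\<^bsub>M\<^esub> x) | r n x.
        r \<in> carrier R \<and> n \<in> carrier N \<and> x \<in> carrier M}"
    then obtain r n x where u: "u = frag_of (r \<odot>\<^bsub>N\<^esub> n, x) - frag_of (n, r \<odot>\<^bsub>M\<^esub> x)"
      and c: "r \<in> carrier R" "n \<in> carrier N" "x \<in> carrier M"
      by blast
    have "h u = \<beta> n (r \<odot>\<^bsub>M\<^esub> x) \<otimes>\<^bsub>H\<^esub> inv\<^bsub>H\<^esub> \<beta> n (r \<odot>\<^bsub>M\<^esub> x)"
      unfolding u using c by (simp only: h_diff frag N.smult_closed M.smult_closed balanced)
    also have "\<dots> = \<one>\<^bsub>H\<^esub>"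
      using closed c by simp
    finally show "u \<in> kernel ?F H h"
      using c unfolding u kernel_def
      by (simp only: h_diff frag N.smult_closed M.smult_closed mem_Collect_eq simp_thms)
  qed
  then have "h (frag_of (n, x)) = \<one>\<^bsub>H\<^esub>"
    using nx(3) by (auto simp: kernel_def)
  then show ?thesis
    using frag nx by simp
qed


section \<open>Disjoint ideals and flatness\<close>

text \<open>The structure of \<open>M\<close> pushed forward along \<open>g\<close>; if \<open>g\<close> identifies elements according to a
  submodule, this is a copy of the quotient module on the image of \<open>g\<close>. The ring multiplication
  and unit of the record carry no information.\<close>

definition pushforward_module :: "('a, 'b, 'm) module_scheme \<Rightarrow> ('b \<Rightarrow> 'c) \<Rightarrow> ('a, 'c) module"
  where "pushforward_module M g =
    \<lparr>carrier = g ` carrier M, monoid.mult = (\<lambda>_ _. g \<zero>\<^bsub>M\<^esub>), one = g \<zero>\<^bsub>M\<^esub>, ring.zero = g \<zero>\<^bsub>M\<^esub>,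
     ring.add = (\<lambda>X Y. g (inv_into (carrier M) g X \<oplus>\<^bsub>M\<^esub> inv_into (carrier M) g Y)),
     smult = (\<lambda>r X. g (r \<odot>\<^bsub>M\<^esub> inv_into (carrier M) g X))\<rparr>"

context module
begin

lemma pushforward_module:
  assumes add: "\<And>x x' y y'. \<lbrakk>x \<in> carrier M; x' \<in> carrier M; y \<in> carrier M; y' \<in> carrier M;
      g x = g x'; g y = g y'\<rbrakk> \<Longrightarrow> g (x \<oplus>\<^bsub>M\<^esub> y) = g (x' \<oplus>\<^bsub>M\<^esub> y')"
    and smult: "\<And>r x x'. \<lbrakk>r \<in> carrier R; x \<in> carrier M; x' \<in> carrier M; g x = g x'\<rbrakk> \<Longrightarrow>
      g (r \<odot>\<^bsub>M\<^esub> x) = g (r \<odot>\<^bsub>M\<^esub> x')"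
  shows "module R (pushforward_module M g)"
    and "carrier (pushforward_module M g) = g ` carrier M"
    and "\<zero>\<^bsub>pushforward_module M g\<^esub> = g \<zero>\<^bsub>M\<^esub>"
    and "\<And>x y. x \<in> carrier M \<Longrightarrow> y \<in> carrier M \<Longrightarrow>
      g x \<oplus>\<^bsub>pushforward_module M g\<^esub> g y = g (x \<oplus>\<^bsub>M\<^esub> y)"
    and "\<And>r x. r \<in> carrier R \<Longrightarrow> x \<in> carrier M \<Longrightarrow>
      r \<odot>\<^bsub>pushforward_module M g\<^esub> g x = g (r \<odot>\<^bsub>M\<^esub> x)"
proof -
  let ?P = "pushforward_module M g"
  show c: "carrier ?P = g ` carrier M" and z: "\<zero>\<^bsub>?P\<^esub> = g \<zero>\<^bsub>M\<^esub>"
    by (simp_all add: pushforward_module_def)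
  have rep: "inv_into (carrier M) g (g x) \<in> carrier M" "g (inv_into (carrier M) g (g x)) = g x"
    if "x \<in> carrier M" for x
    using that by (auto intro: inv_into_into f_inv_into_f)
  show a: "g x \<oplus>\<^bsub>?P\<^esub> g y = g (x \<oplus>\<^bsub>M\<^esub> y)" if "x \<in> carrier M" "y \<in> carrier M" for x y
    using that rep by (auto simp: pushforward_module_def intro!: add)
  show s: "r \<odot>\<^bsub>?P\<^esub> g x = g (r \<odot>\<^bsub>M\<^esub> x)" if "r \<in> carrier R" "x \<in> carrier M" for r x
    using that rep by (auto simp: pushforward_module_def intro!: smult)
  have "abelian_group ?P"
  proof (rule abelian_groupI)
    fix X assume "X \<in> carrier ?P"
    then obtain x where "x \<in> carrier M" "X = g x"
      by (auto simp: c)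
    then show "\<exists>Y\<in>carrier ?P. Y \<oplus>\<^bsub>?P\<^esub> X = \<zero>\<^bsub>?P\<^esub>"
      by (intro bexI[of _ "g (\<ominus>\<^bsub>M\<^esub> x)"]) (auto simp: a c z M.l_neg)
  qed (auto simp: a c z M.a_ac)
  then show "module R ?P"
    by (intro moduleI R.is_cring)
       (auto simp: a c s smult_l_distr smult_r_distr smult_assoc1)
qed

text \<open>The submodule \<open>IM\<close> of \<open>M\<close>; since the products \<open>im\<close> are closed under scalars, additive
  generation suffices.\<close>

definition ideal_smult :: "'a set \<Rightarrow> 'c set"
  where "ideal_smult I = generate (add_monoid M) {i \<odot>\<^bsub>M\<^esub> m | i m. i \<in> I \<and> m \<in> carrier M}"

lemma ideal_smult_induct [consumes 2, case_names zero smult add]: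
  assumes "z \<in> ideal_smult I" and I: "submodule I R (regular_module R)"
    and "Q \<zero>\<^bsub>M\<^esub>"
    and smult: "\<And>i m. i \<in> I \<Longrightarrow> i \<in> carrier R \<Longrightarrow> m \<in> carrier M \<Longrightarrow> Q (i \<odot>\<^bsub>M\<^esub> m)"
    and add: "\<And>x y. x \<in> carrier M \<Longrightarrow> y \<in> carrier M \<Longrightarrow>
      Q x \<Longrightarrow> Q y \<Longrightarrow> Q (x \<oplus>\<^bsub>M\<^esub> y)"
  shows "Q z"
proof -
  interpret R': module R "regular_module R" by (rule R.regular_module)
  have I_R: "i \<in> carrier R" if "i \<in> I" for i
    using that R'.submoduleE(1)[OF I] by auto
  have "z \<in> carrier M \<and> Q z"
    using assms(1) unfolding ideal_smult_def
  proof (induction rule: generate.induct)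
    case (inv h)
    then obtain i m where h: "h = i \<odot>\<^bsub>M\<^esub> m" "i \<in> I" "m \<in> carrier M"
      by blast
    then have "inv\<^bsub>add_monoid M\<^esub> h = i \<odot>\<^bsub>M\<^esub> (\<ominus>\<^bsub>M\<^esub> m)"
      using I_R by (simp add: smult_r_minus a_inv_def[of M, symmetric])
    then show ?case
      using smult[of i "\<ominus>\<^bsub>M\<^esub> m"] h I_R by simp
  qed (use assms(3) smult add I_R in \<open>auto simp: ideal_smult_def\<close>)
  then show ?thesis
    by simp
qed

lemma submodule_ideal_smult:
  assumes I: "submodule I R (regular_module R)"
  shows "submodule (ideal_smult I) R M"
proof (rule submodule_if_add_smult_closed)
  interpret R': module R "regular_module R" by (rule R.regular_module)
  show "ideal_smult I \<subseteq> carrier M"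
  proof
    fix z assume "z \<in> ideal_smult I"
    then show "z \<in> carrier M"
      using I by (induction rule: ideal_smult_induct) auto
  qed
  show "\<zero>\<^bsub>M\<^esub> \<in> ideal_smult I"
    using generate.one[of "add_monoid M"] by (simp add: ideal_smult_def)
  show add_closed: "x \<oplus>\<^bsub>M\<^esub> y \<in> ideal_smult I" if "x \<in> ideal_smult I" "y \<in> ideal_smult I" for x y
    using that generate.eng[of x "add_monoid M"] by (simp add: ideal_smult_def)
  show "r \<odot>\<^bsub>M\<^esub> x \<in> ideal_smult I" if r: "r \<in> carrier R" and "x \<in> ideal_smult I" for r x
    using that(2) I
  proof (induction rule: ideal_smult_induct)
    case zero
    then show ?case
      using r \<open>\<zero>\<^bsub>M\<^esub> \<in> ideal_smult I\<close> by simp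
  next
    case (smult i m)
    then have "r \<odot>\<^bsub>M\<^esub> (i \<odot>\<^bsub>M\<^esub> m) = (r \<otimes> i) \<odot>\<^bsub>M\<^esub> m" "r \<otimes> i \<in> I"
      using r R'.submoduleE(4)[OF I, of r i] by (simp_all add: smult_assoc1)
    then show ?case
      unfolding ideal_smult_def using smult by (intro generate.incl) blast
  next
    case (add x y)
    then show ?case
      using r add_closed by (simp add: smult_r_distr)
  qed
qed

text \<open>If \<open>xR \<inter> I = 0\<close>, the canonical map \<open>xR \<rightarrow> R/I\<close> is injective, hence by flatness so is
  \<open>xR \<otimes> M \<rightarrow> R/I \<otimes> M\<close>. For \<open>xy \<in> IM\<close>, the latter map sends \<open>x \<otimes> y\<close> to \<open>1 \<otimes> xy = 0\<close>. So \<open>x \<otimes> y = 0\<close>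
  already in \<open>xR \<otimes> M\<close>, and evaluation \<open>xR \<otimes> M \<rightarrow> M\<close> gives \<open>xy = 0\<close>. Both \<open>xR\<close> and \<open>R/I\<close> are realised
  by sets of singleton lists, the carrier type that the definition of flatness quantifies over.\<close>

lemma flat_smult_eq_zero:
  assumes flat: "flat_module R M"
    and I: "submodule I R (regular_module R)" and x: "x \<in> carrier R"
    and disj: "\<And>r. r \<in> carrier R \<Longrightarrow> r \<otimes> x \<in> I \<Longrightarrow> r \<otimes> x = \<zero>"
    and y: "y \<in> carrier M" and xy: "x \<odot>\<^bsub>M\<^esub> y \<in> ideal_smult I"
  shows "x \<odot>\<^bsub>M\<^esub> y = \<zero>\<^bsub>M\<^esub>"
proof -
  interpret R': module R "regular_module R" by (rule R.regular_module)
  let ?X = "(\<lambda>r. r \<otimes> x) ` carrier R"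
  have X: "submodule ?X R (regular_module R)"
    using R'.submodule_cyclic[of x] x by simp
  have XR: "a \<in> carrier R" if "a \<in> ?X" for a
    using that x by auto
  have xX: "x \<in> ?X"
    using x by (intro image_eqI[of _ _ \<one>]) auto
  interpret X: module R "regular_module R\<lparr>carrier := ?X\<rparr>"
    by (rule submodule.submodule_is_module[OF X R'.module_axioms])
  define s :: "'a \<Rightarrow> 'a list set" where "s a = {[a]}" for a
  have s_inj: "s a = s b \<longleftrightarrow> a = b" for a b
    by (simp add: s_def)
  define N where "N = pushforward_module (regular_module R\<lparr>carrier := ?X\<rparr>) s"
  note N = X.pushforward_module[of s, folded N_def, simplified s_inj, simplified]
  define q :: "'a \<Rightarrow> 'a list set" where "q a = (\<lambda>b. [b]) ` {b \<in> carrier R. b \<ominus> a \<in> I}" for a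
  have q_eq: "q a = q b \<longleftrightarrow> a \<ominus> b \<in> I" if ab: "a \<in> carrier R" "b \<in> carrier R" for a b
  proof
    assume "q a = q b"
    moreover have "[a] \<in> q a"
      using ab R'.submodule_zero[OF I] by (simp add: q_def R.minus_eq R.r_neg)
    ultimately show "a \<ominus> b \<in> I"
      by (auto simp: q_def)
  next
    assume abI: "a \<ominus> b \<in> I"
    have "c \<ominus> a \<in> I \<longleftrightarrow> c \<ominus> b \<in> I" if "c \<in> carrier R" for c
    proof -
      have "c \<ominus> b = (a \<ominus> b) \<oplus> (c \<ominus> a)"
        using ab that by (simp add: R.minus_eq R.a_ac R.r_neg2)
      then show ?thesis
        using R'.submoduleE(5)[OF I abI, of "c \<ominus> a"] R'.submodule_add_cancel[OF I abI, of "c \<ominus> a"]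
          ab that by auto
    qed
    then show "q a = q b"
      by (auto simp: q_def)
  qed
  define P where "P = pushforward_module (regular_module R) q"
  have P: "module R P" "carrier P = q ` carrier R" "\<zero>\<^bsub>P\<^esub> = q \<zero>"
    "\<And>a b. a \<in> carrier R \<Longrightarrow> b \<in> carrier R \<Longrightarrow> q a \<oplus>\<^bsub>P\<^esub> q b = q (a \<oplus> b)"
    "\<And>a b. a \<in> carrier R \<Longrightarrow> b \<in> carrier R \<Longrightarrow> a \<odot>\<^bsub>P\<^esub> q b = q (a \<otimes> b)"
  proof -
    have add: "q (a \<oplus> b) = q (a' \<oplus> b')"
      if "a \<in> carrier R" "a' \<in> carrier R" "b \<in> carrier R" "b' \<in> carrier R" "q a = q a'" "q b = q b'"
      for a a' b b'
    proof -
      have "(a \<oplus> b) \<ominus> (a' \<oplus> b') = (a \<ominus> a') \<oplus> (b \<ominus> b')"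
        using that(1-4) by (simp add: R.minus_eq R.minus_add R.a_ac)
      then show ?thesis
        using that R'.submoduleE(5)[OF I, of "a \<ominus> a'" "b \<ominus> b'"] by (simp add: q_eq)
    qed
    have smult: "q (r \<otimes> a) = q (r \<otimes> a')"
      if "r \<in> carrier R" "a \<in> carrier R" "a' \<in> carrier R" "q a = q a'" for r a a'
    proof -
      have "(r \<otimes> a) \<ominus> (r \<otimes> a') = r \<otimes> (a \<ominus> a')"
        using that(1-3) by (simp add: R.minus_eq R.r_distr R.r_minus)
      then show ?thesis
        using that R'.submoduleE(4)[OF I, of r "a \<ominus> a'"] by (simp add: q_eq)
    qed
    note P = R'.pushforward_module[of q, folded P_def, simplified, OF add smult]
    show "module R P" "carrier P = q ` carrier R" "\<zero>\<^bsub>P\<^esub> = q \<zero>"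
      "\<And>a b. a \<in> carrier R \<Longrightarrow> b \<in> carrier R \<Longrightarrow> q a \<oplus>\<^bsub>P\<^esub> q b = q (a \<oplus> b)"
      "\<And>a b. a \<in> carrier R \<Longrightarrow> b \<in> carrier R \<Longrightarrow> a \<odot>\<^bsub>P\<^esub> q b = q (a \<otimes> b)"
      by (rule P; assumption)+
  qed
  define f where "f S = q (hd (the_elem S))" for S
  have f_s: "f (s a) = q a" for a
    by (simp add: f_def s_def)
  have f_hom: "f \<in> module_hom R N P"
    unfolding module_hom_def hom_def using XR
    by (auto simp: N P f_s Pi_iff)
  have f_inj: "inj_on f (carrier N)"
  proof (rule inj_onI)
    fix S T assume ST: "S \<in> carrier N" "T \<in> carrier N" "f S = f T"
    have carrier_N: "carrier N = s ` ?X"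
      by (simp add: N)
    obtain a where a: "a \<in> ?X" "S = s a"
      using ST(1) unfolding carrier_N by (rule imageE)
    obtain b where b: "b \<in> ?X" "T = s b"
      using ST(2) unfolding carrier_N by (rule imageE)
    have ab: "a \<in> ?X" "b \<in> ?X" "S = s a" "T = s b" "q a = q b"
      using a b ST(3) by (simp_all only: f_s)
    then have "a \<ominus> b \<in> I"
      using q_eq XR by blast
    moreover obtain r t where "r \<in> carrier R" "t \<in> carrier R" "a = r \<otimes> x" "b = t \<otimes> x"
      using ab by blast
    then have "r \<ominus> t \<in> carrier R" "a \<ominus> b = (r \<ominus> t) \<otimes> x"
      using x by (simp_all add: R.minus_eq R.l_distr R.l_minus)
    ultimately have "a \<ominus> b = \<zero>"
      using disj by metis
    then show "S = T"
      using ab XR R.diff_eq_zero_iff by metis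
  qed
  have IM_rels: "frag_of (q \<one>, z) \<in> tensor_rels R P M" if "z \<in> ideal_smult I" for z
    using that I
  proof (induction rule: ideal_smult_induct)
    case zero
    have "frag_of (\<zero> \<odot>\<^bsub>P\<^esub> q \<one>, \<zero>\<^bsub>M\<^esub>) \<in> tensor_rels R P M"
      using frag_of_zero_in_tensor_rels[OF P(1) module_axioms, of "\<zero>\<^bsub>M\<^esub>"] by (simp add: P)
    then show ?case
      by (subst (asm) frag_of_smult_in_tensor_rels_iff) (auto simp: P module_axioms)
  next
    case (smult i m)
    have "q i = q \<zero>"
      using smult q_eq by (simp add: R.minus_eq)
    then have "frag_of (i \<odot>\<^bsub>P\<^esub> q \<one>, m) \<in> tensor_rels R P M"
      using frag_of_zero_in_tensor_rels[OF P(1) module_axioms, of m] smult by (simp add: P)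
    then show ?case
      using smult by (subst (asm) frag_of_smult_in_tensor_rels_iff) (auto simp: P module_axioms)
  next
    case (add z z')
    then show ?case
      by (intro frag_of_add_in_tensor_rels) (auto simp: P module_axioms)
  qed
  have "frag_of (x \<odot>\<^bsub>P\<^esub> q \<one>, y) \<in> tensor_rels R P M"
    using IM_rels[OF xy] x y by (subst frag_of_smult_in_tensor_rels_iff) (auto simp: P module_axioms)
  then have fx: "frag_of (q x, y) \<in> tensor_rels R P M"
    using x by (simp add: P)
  let ?F = "free_Abelian_group (carrier N \<times> carrier M)"
  let ?G = "free_Abelian_group (carrier P \<times> carrier M)"
  interpret F: group ?F by (rule group_free_Abelian_group)
  interpret G: group ?G by (rule group_free_Abelian_group)
  note sgN = subgroup_tensor_rels[OF N(1) module_axioms]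
    and sgP = subgroup_tensor_rels[OF P(1) module_axioms]
  have sx: "frag_of (s x, y) \<in> carrier ?F"
    using xX y by (simp add: N)
  have "tensor_map R P M f (tensor_rels R N M #>\<^bsub>?F\<^esub> frag_of (s x, y)) =
      tensor_rels R P M #>\<^bsub>?G\<^esub> frag_of (q x, y)"
    using tensor_map_coset[OF N(1) P(1) module_axioms f_hom sx]
    by (simp add: tensor_free_map_def f_s)
  also have "\<dots> = tensor_rels R P M #>\<^bsub>?G\<^esub> 0"
    using G.coset_join2[OF _ sgP fx] G.coset_join2[OF _ sgP, of 0]
      subgroup.mem_carrier[OF sgP fx] subgroup.one_closed[OF sgP] by simp
  also have "\<dots> = tensor_map R P M f (tensor_rels R N M #>\<^bsub>?F\<^esub> 0)"
    using tensor_map_coset[OF N(1) P(1) module_axioms f_hom, of 0]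
    by (simp add: tensor_free_map_def)
  finally have eq: "tensor_map R P M f (tensor_rels R N M #>\<^bsub>?F\<^esub> frag_of (s x, y)) =
      tensor_map R P M f (tensor_rels R N M #>\<^bsub>?F\<^esub> 0)" .
  have "inj_on (tensor_map R P M f) (carrier (tensor R N M))"
    using flat N(1) P(1) f_hom f_inj unfolding flat_module_def by blast
  moreover have "tensor_rels R N M #>\<^bsub>?F\<^esub> z \<in> carrier (tensor R N M)" if "z \<in> carrier ?F" for z
    using that by (auto simp: tensor_def FactGroup_def RCOSETS_def)
  ultimately have "tensor_rels R N M #>\<^bsub>?F\<^esub> frag_of (s x, y) = tensor_rels R N M #>\<^bsub>?F\<^esub> 0"
    using eq sx F.one_closed by (simp add: inj_on_eq_iff)
  also have "\<dots> = tensor_rels R N M"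
    using F.coset_join2[OF _ sgN, of 0] subgroup.one_closed[OF sgN] by simp
  finally have "frag_of (s x, y) \<in> tensor_rels R N M"
    using F.coset_join1[OF _ sx sgN] subgroup.subset[OF sgN] by simp
  moreover define \<beta> where "\<beta> S z = hd (the_elem S) \<odot>\<^bsub>M\<^esub> z" for S :: "'a list set" and z
  have \<beta>: "\<beta> (s a) z = a \<odot>\<^bsub>M\<^esub> z" for a z
    by (simp add: \<beta>_def s_def)
  have N_cases: "\<exists>a. a \<in> ?X \<and> a \<in> carrier R \<and> S = s a" if "S \<in> carrier N" for S
    using that x by (auto simp: N)
  ultimately have "\<beta> (s x) y = \<one>\<^bsub>add_monoid M\<^esub>"
  proof (intro balanced_map_eq_zero_if_in_tensor_rels[OF N(1) module_axioms M.a_comm_group, of \<beta>])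
    fix S z assume "S \<in> carrier N" "z \<in> carrier M"
    then show "\<beta> S z \<in> carrier (add_monoid M)"
      by (elim N_cases[THEN exE] conjE) (simp add: \<beta>)
  next
    fix S T z assume "S \<in> carrier N" "T \<in> carrier N" and z: "z \<in> carrier M"
    then obtain a b where "a \<in> ?X" "b \<in> ?X" "a \<in> carrier R" "b \<in> carrier R" "S = s a" "T = s b"
      using N_cases by metis
    then show "\<beta> (S \<oplus>\<^bsub>N\<^esub> T) z = \<beta> S z \<otimes>\<^bsub>add_monoid M\<^esub> \<beta> T z"
      using z by (simp add: N(4) \<beta> smult_l_distr)
  next
    fix S z z' assume "S \<in> carrier N" "z \<in> carrier M" "z' \<in> carrier M"
    then show "\<beta> S (z \<oplus>\<^bsub>M\<^esub> z') = \<beta> S z \<otimes>\<^bsub>add_monoid M\<^esub> \<beta> S z'"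
      by (elim N_cases[THEN exE] conjE) (simp add: \<beta> smult_r_distr)
  next
    fix r S z assume r: "r \<in> carrier R" and "S \<in> carrier N" and z: "z \<in> carrier M"
    then obtain a where "a \<in> ?X" "a \<in> carrier R" "S = s a"
      using N_cases by metis
    then show "\<beta> (r \<odot>\<^bsub>N\<^esub> S) z = \<beta> S (r \<odot>\<^bsub>M\<^esub> z)"
      using r z by (simp add: N(5) \<beta> R.m_comm[of r a] smult_assoc1)
  next
    show "s x \<in> carrier N"
      using xX by (simp add: N)
  qed (use y in auto)
  then show ?thesis
    by (simp add: \<beta>)
qed

text \<open>For an ideal \<open>J\<close>, let \<open>J \<times> JM\<close> be essential in \<open>eR \<times> eM\<close>. If \<open>x \<in> eR\<close> had no nonzero multiple in
  \<open>J\<close>, a nonzero multiple of \<open>(x, 0)\<close> in \<open>J \<times> JM\<close> would have the form \<open>(0, xy)\<close> with \<open>xy \<in> JM\<close>, which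
  flatness excludes.\<close>

lemma regular_strongly_CS_if_trivial_extension:
  assumes flat: "flat_module R M" and CS: "strongly_CS A regular_A"
  shows "strongly_CS R (regular_module R)"
  unfolding strongly_CS_def
proof (intro allI impI)
  interpret R': module R "regular_module R" by (rule R.regular_module)
  interpret A': module A regular_A by (rule regular_A_module)
  fix J assume J: "submodule J R (regular_module R)"
  have JM: "r \<odot>\<^bsub>M\<^esub> m \<in> ideal_smult J" if "r \<in> J" "m \<in> carrier M" for r m
    unfolding ideal_smult_def using that by (intro generate.incl) blast
  have "submodule (J \<times> ideal_smult J) A regular_A"
    using J submodule_ideal_smult[OF J] JM by (rule submodule_trivial_extension_Times)
  then obtain e where e: "e \<in> carrier R" "e \<otimes> e = e"
    and ess: "essential_in A regular_A (J \<times> ideal_smult J)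
      (((\<lambda>r. e \<otimes> r) ` carrier R) \<times> ((\<lambda>x. e \<odot>\<^bsub>M\<^esub> x) ` carrier M))"
    using trivial_extension_strongly_CSE[OF CS] by blast
  let ?eR = "(\<lambda>r. e \<otimes> r) ` carrier R"
  have "J \<subseteq> ?eR"
    using ess submodule_zero[OF submodule_ideal_smult[OF J]] by (auto simp: A'.essential_in_iff)
  moreover have "\<exists>r\<in>carrier R. r \<otimes> x \<in> J \<and> r \<otimes> x \<noteq> \<zero>" if x: "x \<in> ?eR" "x \<noteq> \<zero>" for x
  proof (rule ccontr)
    assume none: "\<not> (\<exists>r\<in>carrier R. r \<otimes> x \<in> J \<and> r \<otimes> x \<noteq> \<zero>)"
    have xR: "x \<in> carrier R"
      using x e by auto
    have "\<zero>\<^bsub>M\<^esub> \<in> (\<lambda>x. e \<odot>\<^bsub>M\<^esub> x) ` carrier M"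
      using e by (intro image_eqI[of _ _ "\<zero>\<^bsub>M\<^esub>"]) auto
    then obtain p where p: "p \<in> carrier A" "p \<odot>\<^bsub>regular_A\<^esub> (x, \<zero>\<^bsub>M\<^esub>) \<in> J \<times> ideal_smult J"
      "p \<odot>\<^bsub>regular_A\<^esub> (x, \<zero>\<^bsub>M\<^esub>) \<noteq> \<zero>\<^bsub>regular_A\<^esub>"
      using A'.essential_inE[OF ess, of "(x, \<zero>\<^bsub>M\<^esub>)"] x by auto
    then obtain s y where "p = (s, y)" "s \<in> carrier R" "y \<in> carrier M"
      by auto
    then have sy: "s \<otimes> x \<in> J" "x \<odot>\<^bsub>M\<^esub> y \<in> ideal_smult J" "s \<otimes> x \<noteq> \<zero> \<or> x \<odot>\<^bsub>M\<^esub> y \<noteq> \<zero>\<^bsub>M\<^esub>"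
      using p xR by auto
    have "s \<otimes> x = \<zero>"
      using none sy(1) \<open>s \<in> carrier R\<close> by blast
    moreover have "x \<odot>\<^bsub>M\<^esub> y = \<zero>\<^bsub>M\<^esub>"
      using flat_smult_eq_zero[OF flat J xR _ \<open>y \<in> carrier M\<close> sy(2)] none by blast
    ultimately show False
      using sy(3) by simp
  qed
  moreover have "submodule ?eR R (regular_module R)"
    using R'.submodule_smult_image[of e] e by simp
  ultimately have "essential_in R (regular_module R) J ?eR"
    unfolding R'.essential_in_iff using J by simp
  then show "\<exists>e\<in>carrier R. e \<otimes> e = e \<and>
      essential_in R (regular_module R) J ((\<lambda>x. e \<odot>\<^bsub>regular_module R\<^esub> x) ` carrier (regular_module R))"
    using e by auto
qed


section \<open>From the base ring and the module to the trivial extension\<close>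

text \<open>Let \<open>f = 1 - g\<close>, where \<open>g\<close> is the idempotent with kernel \<open>Ann M\<close>; then \<open>A\<close> is the product of \<open>fR\<close>
  and of the trivial extension of \<open>gR\<close> by its faithful module \<open>M\<close>. In the first factor, an ideal \<open>I\<close>
  of \<open>A\<close> is essential in \<open>cfR\<close>, where \<open>cR\<close> is the summand of \<open>R\<close> for \<open>I \<inter> (fR \<times> 0)\<close>. In the second
  factor, everything is controlled by \<open>N = {x. (0, x) \<in> I}\<close>, which is essential in some \<open>eM\<close>: because
  of \<open>IM \<subseteq> N\<close>, faithfulness forces the first components of \<open>I\<close> into \<open>eR\<close>, and it gives each
  element with nonzero first component a nonzero multiple in \<open>0 \<times> eM\<close>. The idempotent for \<open>I\<close> is
  \<open>eg + cf\<close>.\<close>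

lemma trivial_extension_strongly_CS:
  assumes CS_R: "strongly_CS R (regular_module R)" and CS_M: "strongly_CS R M"
    and ds: "direct_summand R (regular_module R) (annihilator R M (carrier M))"
  shows "strongly_CS A regular_A"
  unfolding strongly_CS_def
proof (intro allI impI)
  interpret R': module R "regular_module R" by (rule R.regular_module)
  interpret A': module A regular_A by (rule regular_A_module)
  fix I assume I: "submodule I A regular_A"
  obtain g where g: "g \<in> carrier R" "g \<otimes> g = g"
    and ann: "\<forall>r\<in>carrier R. r \<in> annihilator R M (carrier M) \<longleftrightarrow> g \<otimes> r = \<zero>"
    using ds unfolding annihilator_direct_summand_iff by blast
  note gM = smult_eq_if_annihilator[OF g ann]
  define f where "f = \<one> \<ominus> g"
  have f: "f \<in> carrier R" "f \<otimes> f = f" "g \<otimes> f = \<zero>"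
    using g R.idempotent_complement[OF g] by (simp_all add: f_def)
  have fM: "f \<odot>\<^bsub>M\<^esub> x = \<zero>\<^bsub>M\<^esub>" if "x \<in> carrier M" for x
    using ann f that by (auto simp: annihilator_def)
  have split: "r = g \<otimes> r \<oplus> f \<otimes> r" if "r \<in> carrier R" for r
    unfolding f_def R.mult_left_minus_one[OF g(1) that]
    using g that by (simp add: R.minus_eq R.a_lcomm R.r_neg)
  have faithful: "g \<otimes> r = \<zero>" if "r \<in> carrier R" "\<And>x. x \<in> carrier M \<Longrightarrow> r \<odot>\<^bsub>M\<^esub> x = \<zero>\<^bsub>M\<^esub>" for r
    using ann that by (auto simp: annihilator_def)
  have I_mult: "q \<otimes>\<^bsub>A\<^esub> p \<in> I" if "q \<in> carrier A" "p \<in> I" for p q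
    using A'.submoduleE(4)[OF I] that by simp
  have I_A: "p \<in> carrier A" if "p \<in> I" for p
    using A'.submoduleE(1)[OF I] that by auto

  define N where "N = {x \<in> carrier M. (\<zero>, x) \<in> I}"
  have N: "submodule N R M"
    unfolding N_def by (rule submodule_trivial_extension_snd[OF I])
  obtain e where e: "e \<in> carrier R" "e \<otimes> e = e"
    and essN: "essential_in R M N ((\<lambda>x. e \<odot>\<^bsub>M\<^esub> x) ` carrier M)"
    using CS_M N unfolding strongly_CS_def by blast
  have eN: "e \<odot>\<^bsub>M\<^esub> x = x" if "x \<in> N" for x
    using essN that smult_idempotent[OF e] unfolding essential_in_iff by blast
  define K where "K = {r \<in> carrier R. (r, \<zero>\<^bsub>M\<^esub>) \<in> I \<and> g \<otimes> r = \<zero>}"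
  have K: "submodule K R (regular_module R)"
    unfolding K_def by (rule submodule_trivial_extension_fst[OF I g(1)])
  obtain c where c: "c \<in> carrier R" "c \<otimes> c = c"
    and essK: "essential_in R (regular_module R) K ((\<lambda>x. c \<otimes> x) ` carrier R)"
    using CS_R K unfolding strongly_CS_def regular_module_simps by blast
  have cK: "c \<otimes> r = r" if "r \<in> K" for r
    using essK that R'.smult_idempotent[of c r] c unfolding R'.essential_in_iff by auto

  define h where "h = e \<otimes> g \<oplus> c \<otimes> f"
  have h: "h \<in> carrier R"
    using e g c f by (simp add: h_def)
  have h_mult: "h \<otimes> r = e \<otimes> (g \<otimes> r) \<oplus> c \<otimes> (f \<otimes> r)" if "r \<in> carrier R" for r
    using that e g c f by (simp add: h_def R.l_distr R.m_assoc)
  have hM: "h \<odot>\<^bsub>M\<^esub> x = e \<odot>\<^bsub>M\<^esub> x" if "x \<in> carrier M" for x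
    using that e g c f by (simp add: h_def smult_l_distr smult_assoc1 gM fM)
  have fh: "f \<otimes> (h \<otimes> r) = c \<otimes> (f \<otimes> r)" and gh: "g \<otimes> (h \<otimes> r) = e \<otimes> (g \<otimes> r)" if r: "r \<in> carrier R" for r
  proof -
    have "f \<otimes> (e \<otimes> (g \<otimes> r)) = \<zero>" "f \<otimes> (c \<otimes> (f \<otimes> r)) = c \<otimes> (f \<otimes> r)"
      "g \<otimes> (e \<otimes> (g \<otimes> r)) = e \<otimes> (g \<otimes> r)" "g \<otimes> (c \<otimes> (f \<otimes> r)) = \<zero>"
    proof -
      have "f \<otimes> (e \<otimes> (g \<otimes> r)) = (g \<otimes> f) \<otimes> (e \<otimes> r)" "f \<otimes> (c \<otimes> (f \<otimes> r)) = (f \<otimes> f) \<otimes> (c \<otimes> r)"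
        "c \<otimes> (f \<otimes> r) = f \<otimes> (c \<otimes> r)" "g \<otimes> (e \<otimes> (g \<otimes> r)) = (g \<otimes> g) \<otimes> (e \<otimes> r)"
        "e \<otimes> (g \<otimes> r) = g \<otimes> (e \<otimes> r)" "g \<otimes> (c \<otimes> (f \<otimes> r)) = (g \<otimes> f) \<otimes> (c \<otimes> r)"
        using r e(1) g(1) c(1) f(1) by (simp_all add: R.m_ac)
      then show "f \<otimes> (e \<otimes> (g \<otimes> r)) = \<zero>" "f \<otimes> (c \<otimes> (f \<otimes> r)) = c \<otimes> (f \<otimes> r)"
        "g \<otimes> (e \<otimes> (g \<otimes> r)) = e \<otimes> (g \<otimes> r)" "g \<otimes> (c \<otimes> (f \<otimes> r)) = \<zero>"
        using r e(1) g c(1) f by simp_all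
    qed
    then show "f \<otimes> (h \<otimes> r) = c \<otimes> (f \<otimes> r)" "g \<otimes> (h \<otimes> r) = e \<otimes> (g \<otimes> r)"
      using r e(1) g(1) c(1) f(1) by (simp_all add: h_mult R.r_distr)
  qed
  have h_idem_mult: "h \<otimes> (h \<otimes> r) = h \<otimes> r" if r: "r \<in> carrier R" for r
  proof -
    have "h \<otimes> (h \<otimes> r) = e \<otimes> (e \<otimes> (g \<otimes> r)) \<oplus> c \<otimes> (c \<otimes> (f \<otimes> r))"
      using h_mult[of "h \<otimes> r"] fh gh r h by simp
    also have "\<dots> = h \<otimes> r"
      using r e g(1) c f(1) by (simp add: h_mult R.m_assoc[symmetric])
    finally show ?thesis .
  qed
  have h_idem: "h \<otimes> h = h"
    using h_idem_mult[of \<one>] h by simp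

  have hI: "h \<otimes> r = r \<and> h \<odot>\<^bsub>M\<^esub> x = x" if rx: "(r, x) \<in> I" for r x
  proof -
    have rR: "r \<in> carrier R" and xM: "x \<in> carrier M"
      using I_A[OF rx] by auto
    have "(f \<otimes> r, \<zero>\<^bsub>M\<^esub>) \<in> I"
      using I_mult[of "(f, \<zero>\<^bsub>M\<^esub>)", OF _ rx] f rR xM by (simp add: fM)
    moreover have "g \<otimes> (f \<otimes> r) = \<zero>"
      using f g rR by (simp add: R.m_assoc[symmetric])
    ultimately have "f \<otimes> r \<in> K"
      using f rR by (simp add: K_def)
    then have cf: "c \<otimes> (f \<otimes> r) = f \<otimes> r"
      by (rule cK)
    have "r \<odot>\<^bsub>M\<^esub> y \<in> N" if y: "y \<in> carrier M" for y
      using I_mult[of "(\<zero>, y)", OF _ rx] rR xM y by (simp add: N_def)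
    then have "e \<odot>\<^bsub>M\<^esub> (r \<odot>\<^bsub>M\<^esub> y) = r \<odot>\<^bsub>M\<^esub> y" if "y \<in> carrier M" for y
      using eN that by blast
    then have "g \<otimes> (r \<ominus> e \<otimes> r) = \<zero>"
      using e rR by (intro faithful)
        (simp_all add: R.minus_eq smult_l_distr smult_l_minus smult_assoc1 M.r_neg)
    then have "g \<otimes> r \<ominus> g \<otimes> (e \<otimes> r) = \<zero>"
      using e g rR by (simp add: R.minus_eq R.r_distr R.r_minus)
    then have "e \<otimes> (g \<otimes> r) = g \<otimes> r"
      using e g rR R.diff_eq_zero_iff[of "g \<otimes> r" "g \<otimes> (e \<otimes> r)"] R.m_lcomm[of e g r] by simp
    then have hr: "h \<otimes> r = r"
      using split[OF rR] cf rR by (simp add: h_mult)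
    \<comment> \<open>\<open>g(1 - e)\<close> kills the first component, so that the second one enters \<open>N\<close>.\<close>
    let ?d = "g \<otimes> (\<one> \<ominus> e)"
    have "?d \<otimes> r = \<zero>"
    proof -
      have "?d \<otimes> r = g \<otimes> (r \<ominus> e \<otimes> r)"
        using e g rR by (simp add: R.m_assoc R.mult_left_minus_one)
      then show ?thesis
        using \<open>g \<otimes> (r \<ominus> e \<otimes> r) = \<zero>\<close> by simp
    qed
    moreover have dx: "?d \<odot>\<^bsub>M\<^esub> x = x \<ominus>\<^bsub>M\<^esub> e \<odot>\<^bsub>M\<^esub> x"
      using e g xM
      by (simp add: smult_assoc1 gM R.minus_eq M.minus_eq smult_l_distr smult_l_minus)
    ultimately have "x \<ominus>\<^bsub>M\<^esub> e \<odot>\<^bsub>M\<^esub> x \<in> N"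
      using I_mult[of "(?d, \<zero>\<^bsub>M\<^esub>)", OF _ rx] e g rR xM by (simp add: N_def)
    then have "x \<ominus>\<^bsub>M\<^esub> e \<odot>\<^bsub>M\<^esub> x = e \<odot>\<^bsub>M\<^esub> (x \<ominus>\<^bsub>M\<^esub> e \<odot>\<^bsub>M\<^esub> x)"
      using eN by simp
    also have "\<dots> = \<zero>\<^bsub>M\<^esub>"
      using e xM by (simp add: M.minus_eq smult_r_distr smult_r_minus smult_assoc1[symmetric] M.r_neg)
    finally have "e \<odot>\<^bsub>M\<^esub> x = x"
      using e xM by (simp add: M.minus_eq) (metis M.add.inv_closed M.minus_equality M.minus_minus smult_closed M.a_comm)
    then show ?thesis
      using hr hM xM by simp
  qed

  let ?hA = "(\<lambda>p. (h, \<zero>\<^bsub>M\<^esub>) \<otimes>\<^bsub>A\<^esub> p) ` carrier A"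
  have "I \<subseteq> ?hA"
  proof
    fix p assume p: "p \<in> I"
    then have "(h, \<zero>\<^bsub>M\<^esub>) \<otimes>\<^bsub>A\<^esub> p = p"
      using I_A[OF p] h hI by (cases p) auto
    then show "p \<in> ?hA"
      using I_A[OF p] by (metis image_eqI)
  qed
  moreover have "\<exists>q\<in>carrier A. q \<otimes>\<^bsub>A\<^esub> p \<in> I \<and> q \<otimes>\<^bsub>A\<^esub> p \<noteq> \<zero>\<^bsub>A\<^esub>"
    if p: "p \<in> ?hA" "p \<noteq> \<zero>\<^bsub>A\<^esub>" for p
  proof -
    obtain r x where rx: "p = (r, x)" "r \<in> carrier R" "x \<in> carrier M"
      and hr: "h \<otimes> r = r" and hx: "e \<odot>\<^bsub>M\<^esub> x = x"
    proof -
      obtain r x where rx: "r \<in> carrier R" "x \<in> carrier M" "p = (h, \<zero>\<^bsub>M\<^esub>) \<otimes>\<^bsub>A\<^esub> (r, x)"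
        using p(1) by auto
      then have "p = (h \<otimes> r, e \<odot>\<^bsub>M\<^esub> x)"
        using h e by (simp add: hM)
      then show thesis
        using that[of "h \<otimes> r" "e \<odot>\<^bsub>M\<^esub> x"] rx h e h_idem_mult by (simp add: smult_assoc1[symmetric])
    qed
    have N_I: "\<exists>q\<in>carrier A. q \<otimes>\<^bsub>A\<^esub> p \<in> I \<and> q \<otimes>\<^bsub>A\<^esub> p \<noteq> \<zero>\<^bsub>A\<^esub>"
      if "t \<in> carrier A" "t \<otimes>\<^bsub>A\<^esub> p = (\<zero>, y)" "y \<in> carrier M" and y: "y \<noteq> \<zero>\<^bsub>M\<^esub>" "e \<odot>\<^bsub>M\<^esub> y = y" for t y
    proof -
      have "y \<in> (\<lambda>x. e \<odot>\<^bsub>M\<^esub> x) ` carrier M"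
        using that(3) y(2) by (metis image_eqI)
      then obtain s where s: "s \<in> carrier R" "s \<odot>\<^bsub>M\<^esub> y \<in> N" "s \<odot>\<^bsub>M\<^esub> y \<noteq> \<zero>\<^bsub>M\<^esub>"
        using essential_inE[OF essN] y(1) by metis
      have "(s, \<zero>\<^bsub>M\<^esub>) \<otimes>\<^bsub>A\<^esub> t \<otimes>\<^bsub>A\<^esub> p = (\<zero>, s \<odot>\<^bsub>M\<^esub> y)"
        using A'.R.m_assoc[of "(s, \<zero>\<^bsub>M\<^esub>)" t p] s that(1-3) rx by simp
      then show ?thesis
        using s that(1) A'.R.m_closed[of "(s, \<zero>\<^bsub>M\<^esub>)" t]
        by (intro bexI[of _ "(s, \<zero>\<^bsub>M\<^esub>) \<otimes>\<^bsub>A\<^esub> t"]) (auto simp: N_def)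
    qed
    consider "f \<otimes> r \<noteq> \<zero>" | "f \<otimes> r = \<zero>" "r \<noteq> \<zero>" | "r = \<zero>"
      by blast
    then show ?thesis
    proof cases
      case 1
      have "f \<otimes> r \<in> (\<lambda>x. c \<otimes> x) ` carrier R"
        using fh[OF rx(2)] f rx hr by auto
      then obtain s where s: "s \<in> carrier R" "s \<otimes> (f \<otimes> r) \<in> K" "s \<otimes> (f \<otimes> r) \<noteq> \<zero>"
        using R'.essential_inE[OF essK, of "f \<otimes> r"] 1 by auto
      have "(s \<otimes> f, \<zero>\<^bsub>M\<^esub>) \<otimes>\<^bsub>A\<^esub> p = (s \<otimes> (f \<otimes> r), \<zero>\<^bsub>M\<^esub>)"
        using s f rx by (simp add: smult_assoc1 fM R.m_assoc)
      then show ?thesis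
        using s f by (intro bexI[of _ "(s \<otimes> f, \<zero>\<^bsub>M\<^esub>)"]) (auto simp: K_def)
    next
      case 2
      then have gr: "g \<otimes> r = r"
        using split[OF rx(2)] g rx by simp
      then obtain y where y: "y \<in> carrier M" "r \<odot>\<^bsub>M\<^esub> y \<noteq> \<zero>\<^bsub>M\<^esub>"
        using faithful[OF rx(2)] 2 by metis
      have "e \<otimes> r = r"
        using gh[OF rx(2)] hr gr by simp
      then have "e \<odot>\<^bsub>M\<^esub> (r \<odot>\<^bsub>M\<^esub> y) = r \<odot>\<^bsub>M\<^esub> y"
        using e rx y by (simp add: smult_assoc1[symmetric])
      then show ?thesis
        using N_I[of "(\<zero>, y)" "r \<odot>\<^bsub>M\<^esub> y"] rx y by simp
    next
      case 3
      then show ?thesis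
        using N_I[of "\<one>\<^bsub>A\<^esub>" x] rx p hx by simp
    qed
  qed
  moreover have "submodule ?hA A regular_A"
    using A'.submodule_smult_image[of "(h, \<zero>\<^bsub>M\<^esub>)"] h by simp
  ultimately have "essential_in A regular_A I ?hA"
    unfolding A'.essential_in_iff using I by simp
  then show "\<exists>e\<in>carrier A. e \<otimes>\<^bsub>A\<^esub> e = e \<and>
      essential_in A regular_A I ((\<lambda>p. e \<odot>\<^bsub>regular_A\<^esub> p) ` carrier regular_A)"
    using h h_idem by (intro bexI[of _ "(h, \<zero>\<^bsub>M\<^esub>)"]) simp_all
qed

end


section \<open>The equivalence\<close>

theorem corollary5p6:
  fixes R :: "('a, 'r) ring_scheme" and M :: "('a, 'b, 'm) module_scheme"
  assumes "cring R" and "module R M" and "flat_module R M"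
  shows "(CS_ring (trivial_extension R M) \<longleftrightarrow>
      weakly_IN R (regular_module R) \<and> weakly_IN R M \<and>
      direct_summand R (regular_module R) (annihilator R M (carrier M)))
    \<and> (weakly_IN R (regular_module R) \<and> weakly_IN R M \<and>
      direct_summand R (regular_module R) (annihilator R M (carrier M)) \<longleftrightarrow>
      strongly_CS R (regular_module R) \<and> strongly_CS R M \<and>
      direct_summand R (regular_module R) (annihilator R M (carrier M)))"
proof -
  interpret M: module R M by fact
  interpret R': module R "regular_module R" by (rule M.R.regular_module)
  have IN: "weakly_IN R (regular_module R) \<and> weakly_IN R M \<and>
      direct_summand R (regular_module R) (annihilator R M (carrier M)) \<longleftrightarrow>
      strongly_CS R (regular_module R) \<and> strongly_CS R M \<and>
      direct_summand R (regular_module R) (annihilator R M (carrier M))"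
    using M.R.regular_weakly_IN_imp_strongly_CS M.weakly_IN_imp_strongly_CS
      M.strongly_CS_imp_weakly_IN R'.strongly_CS_imp_weakly_IN by blast
  have "CS_ring (trivial_extension R M) \<longleftrightarrow>
      strongly_CS R (regular_module R) \<and> strongly_CS R M \<and>
      direct_summand R (regular_module R) (annihilator R M (carrier M))"
    unfolding cring.CS_ring_iff_strongly_CS[OF M.trivial_extension_cring]
    using M.trivial_extension_strongly_CS M.strongly_CS_if_trivial_extension
      M.annihilator_direct_summand_if_trivial_extension
      M.regular_strongly_CS_if_trivial_extension[OF assms(3)] by blast
  with IN show ?thesis
    by blast
qed

end
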